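(* Let $\mathcal L$ be a proto-Lagrangian and assume that the Lagrangian functional $\Lambda(\Psi)=\int_{\mathbb R^N}\mathcal L_\Psi(x)\,dx$ is real-valued on the admissible space $\mathcal S$. If $\Psi=\Psi_{\mathrm{Re}}+\mathrm i\Psi_{\mathrm{Im}}\in\mathcal S$ satisfies any one of the following three Lagrangian systems on $\mathbb R^N$, then it also satisfies the other two: (1) $\displaystyle \mathcal L^{(o)}_\Psi-\sum_{\mu=1}^N\frac{\partial}{\partial x^\mu}\mathcal L^{(\mu)}_\Psi=0$; (2) $\displaystyle \mathcal L^{(o\star)}_\Psi-\sum_{\mu=1}^N\frac{\partial}{\partial x^\mu}\mathcal L^{(\mu\star)}_\Psi=0$; (3) the pair of equations $\displaystyle \frac{\partial\mathcal L}{\partial\Psi_{\mathrm{Re}}}-\sum_{\mu=1}^N\frac{\partial}{\partial x^\mu}\frac{\partial\mathcal L}{\partial\Psi_{\mathrm{Re},\mu}}=0$ and $\displaystyle \frac{\partial\mathcal L}{\partial\Psi_{\mathrm{Im}}}-\sum_{\mu=1}^N\frac{\partial}{\partial x^\mu}\frac{\partial\mathcal L}{\partial\Psi_{\mathrm{Im},\mu}}=0$.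
   Context: Fix positive integers $N,r,c$; $^\dagger$ is the conjugate transpose. A proto-Lagrangian is a smooth function $\mathcal L:\mathbb C^{r\times c}\times\mathbb C^{c\times r}\times\mathbb C^{Nr\times c}\times\mathbb C^{c\times Nr}\times\mathbb R^N\to\mathbb C$, $(P;Q^\top;R;S^\top;x)\mapsto\mathcal L(P;Q^\top;R;S^\top;x)$, holomorphic in the matrix arguments, which vanishes when all matrix arguments are $0$. Here $R=\mathrm{col}[R_1,\dots,R_N]$ with $R_\mu\in\mathbb C^{r\times c}$ and $S^\top=\mathrm{row}[S_1^\top,\dots,S_N^\top]$ with $S_\mu^\top\in\mathbb C^{c\times r}$. Derivative convention: for a function $F$ of a matrix $Z\in\mathbb C^{p\times q}$ (or real matrix), $\partial F/\partial Z$ is the $q\times p$ matrix with $(i,j)$ entry $\partial F/\partial Z_{ji}$. The complex partial derivatives of $\mathcal L$ with respect to $P,Q^\top,R_\mu,S_\mu^\top$ are denoted $\mathcal L^{(o)},\mathcal L^{(o\star)},\mathcal L^{(\mu)},\mathcal L^{(\mu\star)}$. For smooth $\Psi:\mathbb R^N\to\mathbb C^{r\times c}$ the Lagrangian density is $\mathcal L_\Psi(x)=\mathcal L(\Psi(x);\Psi^\dagger(x);\nabla\Psi(x);\nabla\Psi^\dagger(x);x)$, with $\nabla\Psi=\mathrm{col}[\partial_1\Psi,\dots,\partial_N\Psi]$, $\nabla\Psi^\dagger=\mathrm{row}[\partial_1\Psi^\dagger,\dots,\partial_N\Psi^\dagger]$. Likewise $\mathcal L^{(o)}_\Psi,\mathcal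 L^{(o\star)}_\Psi,\mathcal L^{(\mu)}_\Psi,\mathcal L^{(\mu\star)}_\Psi$ are the functions of $x$ obtained by the same substitution. In (3), $\Psi_{\mathrm{Re}},\Psi_{\mathrm{Im}}$ are the (entrywise) real and imaginary parts of $\Psi$, $\Psi_{\mathrm{Re},\mu}=\partial_\mu\Psi_{\mathrm{Re}}$, $\Psi_{\mathrm{Im},\mu}=\partial_\mu\Psi_{\mathrm{Im}}$, and $\partial\mathcal L/\partial\Psi_{\mathrm{Re}}$, $\partial\mathcal L/\partial\Psi_{\mathrm{Im}}$, $\partial\mathcal L/\partial\Psi_{\mathrm{Re},\mu}$, $\partial\mathcal L/\partial\Psi_{\mathrm{Im},\mu}$ are the real partial derivatives, with respect to the real matrices $X,Y,X_\mu,Y_\mu$, of the function $\mathcal L(X+\mathrm iY;X^\top-\mathrm iY^\top;\mathrm{col}[X_\mu+\mathrm iY_\mu]_\mu;\mathrm{row}[X_\mu^\top-\mathrm iY_\mu^\top]_\mu;x)$, evaluated at $X=\Psi_{\mathrm{Re}}(x)$, $Y=\Psi_{\mathrm{Im}}(x)$, $X_\mu=\partial_\mu\Psi_{\mathrm{Re}}(x)$, $Y_\mu=\partial_\mu\Psi_{\mathrm{Im}}(x)$. The admissible space $\mathcal S$ is a set of smooth functions $\Psi:\mathbb R^N\to\mathbb C^{r\times c}$ for which $\mathcal L_\Psi$ is absolutely integrable, and such that $\Psi+H\in\mathcal S$ for all $\Psi\in\mathcal S$ and all compactly supported smooth $H:\mathbb R^N\to\mathbb C^{r\times c}$. (Real-valuedness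 of $\Lambda$ does not require $\mathcal L_\Psi$ to be real-valued pointwise.) *)

theory Defs
  imports "HOL-Analysis.Analysis"
begin

text \<open>Since the domain is finite dimensional, \<open>C\<^sup>k\<^sup>+\<^sup>1\<close> regularity may be tested on the derivatives in all
  fixed directions \<open>v\<close>; this keeps the type of the maps unchanged in the recursion.\<close>

primrec Ck_map :: "nat \<Rightarrow> ('a::euclidean_space \<Rightarrow> 'b::euclidean_space) \<Rightarrow> bool" where
  "Ck_map 0 f \<longleftrightarrow> continuous_on UNIV f"
| "Ck_map (Suc k) f \<longleftrightarrow>
     (\<forall>x. f differentiable (at x)) \<and> (\<forall>v. Ck_map k (\<lambda>x. frechet_derivative f (at x) v))"

definition smooth_map :: "('a::euclidean_space \<Rightarrow> 'b::euclidean_space) \<Rightarrow> bool" where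
  "smooth_map f \<longleftrightarrow> (\<forall>k. Ck_map k f)"

definition coord_deriv ::
  "'n \<Rightarrow> (real^'n \<Rightarrow> 'a::real_normed_vector) \<Rightarrow> real^'n::finite \<Rightarrow> 'a" where
  "coord_deriv \<mu> F x = vector_derivative (\<lambda>t. F (x + t *\<^sub>R axis \<mu> 1)) (at 0)"

text \<open>A \<open>p \<times> q\<close> matrix has type \<^typ>\<open>'a^'q^'p\<close>.  The \<open>N r\<close> rows of \<open>R\<close> and the \<open>N r\<close> columns
  of \<open>S\<^sup>T\<close> are indexed by pairs \<open>(\<mu>, i)\<close> of a block index and an index inside that block.\<close>

definition conj_transpose :: "complex^'q::finite^'p::finite \<Rightarrow> complex^'p^'q" where
  "conj_transpose A = map_matrix cnj (transpose A)"

definition complex_matrix ::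
  "real^'q::finite^'p::finite \<Rightarrow> real^'q^'p \<Rightarrow> complex^'q^'p" where
  "complex_matrix X Y = (\<chi> i j. Complex (X $ i $ j) (Y $ i $ j))"

definition col_blocks ::
  "('n \<Rightarrow> complex^'c^'r) \<Rightarrow> complex^'c::finite^('n::finite \<times> 'r::finite)" where
  "col_blocks B = (\<chi> k j. B (fst k) $ snd k $ j)"

definition row_blocks ::
  "('n \<Rightarrow> complex^'r^'c) \<Rightarrow> complex^('n::finite \<times> 'r::finite)^'c::finite" where
  "row_blocks B = (\<chi> i k. B (fst k) $ i $ snd k)"

definition col_block ::
  "complex^'c::finite^('n::finite \<times> 'r::finite) \<Rightarrow> 'n \<Rightarrow> complex^'c^'r" where
  "col_block R \<mu> = (\<chi> i j. R $ (\<mu>, i) $ j)"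

definition row_block ::
  "complex^('n::finite \<times> 'r::finite)^'c::finite \<Rightarrow> 'n \<Rightarrow> complex^'r^'c" where
  "row_block S \<mu> = (\<chi> i j. S $ i $ (\<mu>, j))"

definition update_entry :: "'a^'q::finite^'p::finite \<Rightarrow> 'p \<Rightarrow> 'q \<Rightarrow> 'a \<Rightarrow> 'a^'q^'p" where
  "update_entry Z i j z = (\<chi> k l. if k = i \<and> l = j then z else Z $ k $ l)"

text \<open>The derivative with respect to a \<open>p \<times> q\<close> matrix is the \<open>q \<times> p\<close> matrix whose \<open>(i, j)\<close> entry
  is the partial derivative in the \<open>(j, i)\<close> entry of the argument.\<close>

definition complex_matrix_deriv ::
  "(complex^'q^'p \<Rightarrow> complex) \<Rightarrow> complex^'q::finite^'p::finite \<Rightarrow> complex^'p^'q" where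
  "complex_matrix_deriv F Z = (\<chi> i j. deriv (\<lambda>z. F (update_entry Z j i z)) (Z $ j $ i))"

definition real_matrix_deriv ::
  "(real^'q^'p \<Rightarrow> complex) \<Rightarrow> real^'q::finite^'p::finite \<Rightarrow> complex^'p^'q" where
  "real_matrix_deriv F Z =
     (\<chi> i j. vector_derivative (\<lambda>t. F (update_entry Z j i t)) (at (Z $ j $ i)))"

text \<open>The arguments \<open>(P; Q\<^sup>T; R; S\<^sup>T; x)\<close>.\<close>

type_synonym ('n, 'r, 'c) lagr_arg =
  "(complex^'c^'r) \<times> (complex^'r^'c) \<times> (complex^'c^('n \<times> 'r)) \<times> (complex^('n \<times> 'r)^'c) \<times> (real^'n)"

text \<open>Holomorphy in several variables: the real Frechet derivative in the matrix arguments is complex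
  linear.  The nested vector types carry no complex scalar multiplication, hence \<^const>\<open>map_matrix\<close>.\<close>

definition holomorphic_in_matrices ::
  "(('n::finite, 'r::finite, 'c::finite) lagr_arg \<Rightarrow> complex) \<Rightarrow> bool" where
  "holomorphic_in_matrices L \<longleftrightarrow>
     (\<forall>P Q R S x. \<exists>D.
        ((\<lambda>(P, Q, R, S). L (P, Q, R, S, x)) has_derivative D) (at (P, Q, R, S)) \<and>
        (\<forall>z A B C E.
           D (map_matrix ((*) z) A, map_matrix ((*) z) B, map_matrix ((*) z) C, map_matrix ((*) z) E)
             = z * D (A, B, C, E)))"

definition proto_lagrangian ::
  "(('n::finite, 'r::finite, 'c::finite) lagr_arg \<Rightarrow> complex) \<Rightarrow> bool" where
  "proto_lagrangian L \<longleftrightarrow>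
     smooth_map L \<and> holomorphic_in_matrices L \<and> (\<forall>x. L (0, 0, 0, 0, x) = 0)"

text \<open>The derivatives \<open>L_mu\<close>, \<open>L_mu_star\<close> are taken in one block of \<open>R\<close>, \<open>S\<^sup>T\<close>, the other blocks being kept fixed.\<close>

definition L_o ::
  "(('n::finite, 'r::finite, 'c::finite) lagr_arg \<Rightarrow> complex) \<Rightarrow> ('n, 'r, 'c) lagr_arg
    \<Rightarrow> complex^'r^'c" where
  "L_o L = (\<lambda>(P, Q, R, S, x). complex_matrix_deriv (\<lambda>Z. L (Z, Q, R, S, x)) P)"

definition L_o_star ::
  "(('n::finite, 'r::finite, 'c::finite) lagr_arg \<Rightarrow> complex) \<Rightarrow> ('n, 'r, 'c) lagr_arg
    \<Rightarrow> complex^'c^'r" where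
  "L_o_star L = (\<lambda>(P, Q, R, S, x). complex_matrix_deriv (\<lambda>Z. L (P, Z, R, S, x)) Q)"

definition L_mu ::
  "(('n::finite, 'r::finite, 'c::finite) lagr_arg \<Rightarrow> complex) \<Rightarrow> 'n \<Rightarrow> ('n, 'r, 'c) lagr_arg
    \<Rightarrow> complex^'r^'c" where
  "L_mu L \<mu> = (\<lambda>(P, Q, R, S, x).
     complex_matrix_deriv (\<lambda>Z. L (P, Q, col_blocks ((col_block R)(\<mu> := Z)), S, x)) (col_block R \<mu>))"

definition L_mu_star ::
  "(('n::finite, 'r::finite, 'c::finite) lagr_arg \<Rightarrow> complex) \<Rightarrow> 'n \<Rightarrow> ('n, 'r, 'c) lagr_arg
    \<Rightarrow> complex^'c^'r" where
  "L_mu_star L \<mu> = (\<lambda>(P, Q, R, S, x).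
     complex_matrix_deriv (\<lambda>Z. L (P, Q, R, row_blocks ((row_block S)(\<mu> := Z)), x)) (row_block S \<mu>))"

definition field_arg ::
  "(real^'n \<Rightarrow> complex^'c^'r) \<Rightarrow> real^'n \<Rightarrow> ('n::finite, 'r::finite, 'c::finite) lagr_arg" where
  "field_arg \<Psi> x =
     (\<Psi> x,
      conj_transpose (\<Psi> x),
      col_blocks (\<lambda>\<mu>. coord_deriv \<mu> \<Psi> x),
      row_blocks (\<lambda>\<mu>. coord_deriv \<mu> (\<lambda>y. conj_transpose (\<Psi> y)) x),
      x)"

definition lagrangian_density ::
  "(('n::finite, 'r::finite, 'c::finite) lagr_arg \<Rightarrow> complex)
    \<Rightarrow> (real^'n \<Rightarrow> complex^'c^'r) \<Rightarrow> real^'n \<Rightarrow> complex" where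
  "lagrangian_density L \<Psi> x = L (field_arg \<Psi> x)"

definition lagrangian_functional ::
  "(('n::finite, 'r::finite, 'c::finite) lagr_arg \<Rightarrow> complex)
    \<Rightarrow> (real^'n \<Rightarrow> complex^'c^'r) \<Rightarrow> complex" where
  "lagrangian_functional L \<Psi> = (\<integral>x. lagrangian_density L \<Psi> x \<partial>lborel)"

definition admissible_space ::
  "(('n::finite, 'r::finite, 'c::finite) lagr_arg \<Rightarrow> complex)
    \<Rightarrow> (real^'n \<Rightarrow> complex^'c^'r) set \<Rightarrow> bool" where
  "admissible_space L \<S> \<longleftrightarrow>
     (\<forall>\<Psi>\<in>\<S>. smooth_map \<Psi> \<and> integrable lborel (lagrangian_density L \<Psi>)) \<and>
     (\<forall>\<Psi>\<in>\<S>. \<forall>H. smooth_map H \<and> compact (closure {x. H x \<noteq> 0}) \<longrightarrow> (\<lambda>x. \<Psi> x + H x) \<in> \<S>)"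

definition lagrangian_system ::
  "(('n::finite, 'r::finite, 'c::finite) lagr_arg \<Rightarrow> complex)
    \<Rightarrow> (real^'n \<Rightarrow> complex^'c^'r) \<Rightarrow> bool" where
  "lagrangian_system L \<Psi> \<longleftrightarrow>
     (\<forall>x. L_o L (field_arg \<Psi> x)
          - (\<Sum>\<mu>\<in>UNIV. coord_deriv \<mu> (\<lambda>y. L_mu L \<mu> (field_arg \<Psi> y)) x) = 0)"

definition lagrangian_system_star ::
  "(('n::finite, 'r::finite, 'c::finite) lagr_arg \<Rightarrow> complex)
    \<Rightarrow> (real^'n \<Rightarrow> complex^'c^'r) \<Rightarrow> bool" where
  "lagrangian_system_star L \<Psi> \<longleftrightarrow>
     (\<forall>x. L_o_star L (field_arg \<Psi> x)
          - (\<Sum>\<mu>\<in>UNIV. coord_deriv \<mu> (\<lambda>y. L_mu_star L \<mu> (field_arg \<Psi> y)) x) = 0)"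

definition real_lagrangian ::
  "(('n::finite, 'r::finite, 'c::finite) lagr_arg \<Rightarrow> complex)
    \<Rightarrow> real^'c^'r \<Rightarrow> real^'c^'r \<Rightarrow> ('n \<Rightarrow> real^'c^'r) \<Rightarrow> ('n \<Rightarrow> real^'c^'r) \<Rightarrow> real^'n \<Rightarrow> complex" where
  "real_lagrangian L X Y Xs Ys x =
     L (complex_matrix X Y,
        complex_matrix (transpose X) (- transpose Y),
        col_blocks (\<lambda>\<mu>. complex_matrix (Xs \<mu>) (Ys \<mu>)),
        row_blocks (\<lambda>\<mu>. complex_matrix (transpose (Xs \<mu>)) (- transpose (Ys \<mu>))),
        x)"

definition Re_part :: "('a \<Rightarrow> complex^'c::finite^'r::finite) \<Rightarrow> 'a \<Rightarrow> real^'c^'r" where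
  "Re_part \<Psi> x = map_matrix Re (\<Psi> x)"

definition Im_part :: "('a \<Rightarrow> complex^'c::finite^'r::finite) \<Rightarrow> 'a \<Rightarrow> real^'c^'r" where
  "Im_part \<Psi> x = map_matrix Im (\<Psi> x)"

definition dL_Re ::
  "(('n::finite, 'r::finite, 'c::finite) lagr_arg \<Rightarrow> complex)
    \<Rightarrow> (real^'n \<Rightarrow> complex^'c^'r) \<Rightarrow> real^'n \<Rightarrow> complex^'r^'c" where
  "dL_Re L \<Psi> x =
     real_matrix_deriv
       (\<lambda>X. real_lagrangian L X (Im_part \<Psi> x)
              (\<lambda>\<nu>. coord_deriv \<nu> (Re_part \<Psi>) x) (\<lambda>\<nu>. coord_deriv \<nu> (Im_part \<Psi>) x) x)
       (Re_part \<Psi> x)"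

definition dL_Im ::
  "(('n::finite, 'r::finite, 'c::finite) lagr_arg \<Rightarrow> complex)
    \<Rightarrow> (real^'n \<Rightarrow> complex^'c^'r) \<Rightarrow> real^'n \<Rightarrow> complex^'r^'c" where
  "dL_Im L \<Psi> x =
     real_matrix_deriv
       (\<lambda>Y. real_lagrangian L (Re_part \<Psi> x) Y
              (\<lambda>\<nu>. coord_deriv \<nu> (Re_part \<Psi>) x) (\<lambda>\<nu>. coord_deriv \<nu> (Im_part \<Psi>) x) x)
       (Im_part \<Psi> x)"

definition dL_Re_mu ::
  "(('n::finite, 'r::finite, 'c::finite) lagr_arg \<Rightarrow> complex)
    \<Rightarrow> (real^'n \<Rightarrow> complex^'c^'r) \<Rightarrow> 'n \<Rightarrow> real^'n \<Rightarrow> complex^'r^'c" where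
  "dL_Re_mu L \<Psi> \<mu> x =
     real_matrix_deriv
       (\<lambda>Z. real_lagrangian L (Re_part \<Psi> x) (Im_part \<Psi> x)
              ((\<lambda>\<nu>. coord_deriv \<nu> (Re_part \<Psi>) x)(\<mu> := Z)) (\<lambda>\<nu>. coord_deriv \<nu> (Im_part \<Psi>) x) x)
       (coord_deriv \<mu> (Re_part \<Psi>) x)"

definition dL_Im_mu ::
  "(('n::finite, 'r::finite, 'c::finite) lagr_arg \<Rightarrow> complex)
    \<Rightarrow> (real^'n \<Rightarrow> complex^'c^'r) \<Rightarrow> 'n \<Rightarrow> real^'n \<Rightarrow> complex^'r^'c" where
  "dL_Im_mu L \<Psi> \<mu> x =
     real_matrix_deriv
       (\<lambda>Z. real_lagrangian L (Re_part \<Psi> x) (Im_part \<Psi> x)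
              (\<lambda>\<nu>. coord_deriv \<nu> (Re_part \<Psi>) x) ((\<lambda>\<nu>. coord_deriv \<nu> (Im_part \<Psi>) x)(\<mu> := Z)) x)
       (coord_deriv \<mu> (Im_part \<Psi>) x)"

definition lagrangian_system_real ::
  "(('n::finite, 'r::finite, 'c::finite) lagr_arg \<Rightarrow> complex)
    \<Rightarrow> (real^'n \<Rightarrow> complex^'c^'r) \<Rightarrow> bool" where
  "lagrangian_system_real L \<Psi> \<longleftrightarrow>
     (\<forall>x. dL_Re L \<Psi> x - (\<Sum>\<mu>\<in>UNIV. coord_deriv \<mu> (dL_Re_mu L \<Psi> \<mu>) x) = 0) \<and>
     (\<forall>x. dL_Im L \<Psi> x - (\<Sum>\<mu>\<in>UNIV. coord_deriv \<mu> (dL_Im_mu L \<Psi> \<mu>) x) = 0)"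

end

theory Submission
  imports Defs
begin

text \<open>
  Let \<open>a\<close> and \<open>b\<close> be corresponding entries of the left-hand sides of (1) and (2).  Varying \<open>\<Psi>\<close> by \<open>t \<phi> M\<close>
  with a bump function \<open>\<phi>\<close> and a matrix \<open>M\<close> with the single nonzero entry \<open>z\<close>, differentiating the
  functional at \<open>t = 0\<close> and integrating by parts gives \<open>\<integral> \<phi> (z a + cnj z b)\<close>, because the derivative of
  the Lagrangian is complex linear in the matrix arguments.  Only the difference of the densities, which
  has compact support, is differentiated under the integral.  As the functional is real,
  \<open>z a + cnj z b\<close> is real everywhere for \<open>z = 1\<close> and \<open>z = \<i>\<close>, which means \<open>b = cnj a\<close>.  The real system
  (3) is \<open>a + b = 0\<close> and \<open>\<i> (a - b) = 0\<close>, so each of the three systems says \<open>a = 0\<close>.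
\<close>

section \<open>Smooth maps\<close>

lemma smooth_map_has_derivative:
  assumes "smooth_map f"
  shows "(f has_derivative frechet_derivative f (at x)) (at x)"
proof -
  have "Ck_map (Suc 0) f"
    using assms by (simp add: smooth_map_def)
  then show ?thesis
    by (simp add: frechet_derivative_works)
qed

lemma smooth_map_continuous_on:
  assumes "smooth_map f"
  shows "continuous_on S f"
proof -
  have "Ck_map 0 f"
    using assms by (simp add: smooth_map_def)
  then show ?thesis
    using continuous_on_subset by force
qed

lemma smooth_map_frechet_derivative:
  assumes "smooth_map f"
  shows "smooth_map (\<lambda>x. frechet_derivative f (at x) v)"
  using assms unfolding smooth_map_def by (metis Ck_map.simps(2))

text \<open>\<open>Ck_map\<close> recurses through derivatives in fixed directions, so induction on
  \<open>k\<close> covers every member of a class of differentiable maps that is closed under these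
  derivatives. Smoothness is then shown by naming such a class, without any formula for higher
  derivatives.\<close>

lemma smooth_map_coinduct:
  assumes "f \<in> F"
    and "\<And>g x. g \<in> F \<Longrightarrow> g differentiable (at x)"
    and "\<And>g v. g \<in> F \<Longrightarrow> (\<lambda>x. frechet_derivative g (at x) v) \<in> F"
  shows "smooth_map f"
proof -
  have "Ck_map k g" if "g \<in> F" for k g
    using that
  proof (induction k arbitrary: g)
    case 0
    then show ?case
      by (auto intro!: differentiable_imp_continuous_on assms(2) simp: differentiable_on_def differentiable_at_withinI)
  next
    case (Suc k)
    then show ?case
      using assms(2,3) by auto
  qed
  then show ?thesis
    using assms(1) by (simp add: smooth_map_def)
qed

lemma smooth_map_const: "smooth_map (\<lambda>x. c)"
  by (rule smooth_map_coinduct[where F = "range (\<lambda>c x. c)"]) auto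

text \<open>The derivative of \<open>T\<close> is \<open>T\<close> at every point, so its
  directional derivatives are constants and the class need only contain \<open>T\<close> and the
  constants.\<close>

lemma smooth_map_linear:
  assumes "bounded_linear T"
  shows "smooth_map T"
proof (rule smooth_map_coinduct[where F = "insert T (range (\<lambda>c x. c))"])
  have "frechet_derivative T (at x) = T" for x
    using frechet_derivative_at[OF bounded_linear_imp_has_derivative[OF assms]] by simp
  then show "(\<lambda>x. frechet_derivative g (at x) v) \<in> insert T (range (\<lambda>c x. c))"
    if "g \<in> insert T (range (\<lambda>c x. c))" for g v
    using that by auto
qed (auto intro: bounded_linear_imp_differentiable assms)

text \<open>Differentiation passes through \<open>T\<close>, so the maps \<open>T (g x)\<close> with
  \<open>g\<close> smooth form a closed class. This stands in for a higher-order chain rule.\<close>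

lemma smooth_map_linear_image:
  assumes T: "bounded_linear T" and "smooth_map f"
  shows "smooth_map (\<lambda>x. T (f x))"
proof (rule smooth_map_coinduct[where F = "{\<lambda>x. T (g x) | g. smooth_map g}"])
  have *: "((\<lambda>x. T (g x)) has_derivative (\<lambda>v. T (frechet_derivative g (at x) v))) (at x)"
    if "smooth_map g" for g x
    by (rule bounded_linear.has_derivative[OF T smooth_map_has_derivative[OF that]])
  show "h differentiable (at x)" if "h \<in> {\<lambda>x. T (g x) | g. smooth_map g}" for h x
    using that * by (auto simp: differentiable_def)
  show "(\<lambda>x. frechet_derivative h (at x) v) \<in> {\<lambda>x. T (g x) | g. smooth_map g}"
    if h: "h \<in> {\<lambda>x. T (g x) | g. smooth_map g}" for h v
  proof -
    obtain g where g: "h = (\<lambda>x. T (g x))" "smooth_map g"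
      using h by blast
    have "(\<lambda>x. frechet_derivative h (at x) v) = (\<lambda>x. T (frechet_derivative g (at x) v))"
      using frechet_derivative_at[OF *[OF g(2)]] by (simp add: g(1) fun_eq_iff)
    then show ?thesis
      unfolding mem_Collect_eq
      by (intro exI[of _ "\<lambda>x. frechet_derivative g (at x) v"] conjI
          smooth_map_frechet_derivative g(2))
  qed
qed (use assms in blast)

lemma smooth_map_add:
  assumes "smooth_map f" "smooth_map g"
  shows "smooth_map (\<lambda>x. f x + g x)"
proof (rule smooth_map_coinduct[where F = "{\<lambda>x. f x + g x | f g. smooth_map f \<and> smooth_map g}"])
  have *: "((\<lambda>x. f x + g x) has_derivative
      (\<lambda>v. frechet_derivative f (at x) v + frechet_derivative g (at x) v)) (at x)"
    if "smooth_map f" "smooth_map g" for f g x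
    by (intro has_derivative_add smooth_map_has_derivative that)
  show "h differentiable (at x)"
    if "h \<in> {\<lambda>x. f x + g x | f g. smooth_map f \<and> smooth_map g}" for h x
    using that * by (auto simp: differentiable_def)
  show "(\<lambda>x. frechet_derivative h (at x) v) \<in> {\<lambda>x. f x + g x | f g. smooth_map f \<and> smooth_map g}"
    if h: "h \<in> {\<lambda>x. f x + g x | f g. smooth_map f \<and> smooth_map g}" for h v
  proof -
    obtain f g where fg: "h = (\<lambda>x. f x + g x)" "smooth_map f" "smooth_map g"
      using h by blast
    have "(\<lambda>x. frechet_derivative h (at x) v) =
        (\<lambda>x. frechet_derivative f (at x) v + frechet_derivative g (at x) v)"
      using frechet_derivative_at[OF *[OF fg(2,3)]] by (simp add: fg(1) fun_eq_iff)
    then show ?thesis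
      unfolding mem_Collect_eq
      by (intro exI[of _ "\<lambda>x. frechet_derivative f (at x) v"]
          exI[of _ "\<lambda>x. frechet_derivative g (at x) v"] conjI smooth_map_frechet_derivative fg(2,3))
  qed
qed (use assms in blast)

lemma smooth_map_sum:
  assumes "\<And>i. i \<in> I \<Longrightarrow> smooth_map (f i)"
  shows "smooth_map (\<lambda>x. \<Sum>i\<in>I. f i x)"
  using assms
  by (induction I rule: infinite_finite_induct) (auto intro: smooth_map_const smooth_map_add)

text \<open>Smoothness gives continuity of the derivative only for each fixed direction. Expanding
  \<open>w x\<close> in the finite basis turns this into joint continuity in point and
  direction.\<close>

lemma continuous_on_frechet_derivative_compose:
  assumes G: "smooth_map G" and f: "continuous_on S f" and w: "continuous_on S w"
  shows "continuous_on S (\<lambda>x. frechet_derivative G (at (f x)) (w x))"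
proof -
  have lin: "linear (frechet_derivative G (at y))" for y
    using smooth_map_has_derivative[OF G] has_derivative_linear by blast
  have "frechet_derivative G (at (f x)) (w x) =
      (\<Sum>b\<in>Basis. (w x \<bullet> b) *\<^sub>R frechet_derivative G (at (f x)) b)" for x
    by (subst euclidean_representation[of "w x", symmetric])
      (simp only: linear_sum[OF lin] linear_scale[OF lin])
  moreover have "continuous_on S (\<lambda>x. frechet_derivative G (at (f x)) b)" for b
    by (rule continuous_on_compose2[OF smooth_map_continuous_on[OF smooth_map_frechet_derivative[OF G]] f, of UNIV]) auto
  ultimately show ?thesis
    using w by (simp only:) (intro continuous_intros)
qed

section \<open>Bump functions\<close>

text \<open>For \<open>k = 0\<close> this is the classical smooth function that is flat at the
  origin. The exponent \<open>k\<close> is carried along so that derivatives stay in the span of the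
  family.\<close>

definition flat_exp :: "nat \<Rightarrow> real \<Rightarrow> real" where
  "flat_exp k t = (if t > 0 then exp (- (1 / t)) / t ^ k else 0)"

lemma flat_exp_has_derivative:
  "(flat_exp k has_real_derivative flat_exp (k + 2) t - real k * flat_exp (k + 1) t) (at t)"
proof -
  consider "t > 0" | "t < 0" | "t = 0" by linarith
  then show ?thesis
  proof cases
    case 1
    \<comment> \<open>The case split on \<open>k\<close> at the end resolves the truncated exponent
      \<open>k - 1\<close> that comes from differentiating \<open>t ^ k\<close>.\<close>
    have "((\<lambda>t. exp (- (1 / t)) / t ^ k) has_real_derivative
        flat_exp (k + 2) t - real k * flat_exp (k + 1) t) (at t)"
      by (rule derivative_eq_intros refl | use 1 in force)+
        (use 1 in \<open>cases k; simp add: flat_exp_def field_simps power2_eq_square\<close>)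
    then show ?thesis
      by (rule has_field_derivative_transform_within[where d = t])
        (use 1 in \<open>auto simp: flat_exp_def dist_real_def\<close>)
  next
    case 2
    have "((\<lambda>t. 0) has_real_derivative
        flat_exp (k + 2) t - real k * flat_exp (k + 1) t) (at t)"
      using 2 by (simp add: flat_exp_def)
    then show ?thesis
      by (rule has_field_derivative_transform_within[where d = "-t"])
        (use 2 in \<open>auto simp: flat_exp_def dist_real_def\<close>)
  next
    case 3
    \<comment> \<open>With \<open>x = 1 / h\<close> this is the right-hand difference quotient at 0;
      the additional power in \<open>Suc k\<close> is the division by \<open>h\<close>.\<close>
    have "((\<lambda>x::real. x ^ Suc k / exp x) \<longlongrightarrow> 0) at_top"
      by (rule tendsto_power_div_exp_0)
    then have "((\<lambda>h. inverse h ^ Suc k / exp (inverse h)) \<longlongrightarrow> (0::real)) (at_right 0)"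
      by (rule filterlim_compose) (rule filterlim_inverse_at_top_right)
    then have "((\<lambda>h. flat_exp k h / h) \<longlongrightarrow> 0) (at_right 0)"
      by (rule Lim_transform_eventually)
        (auto simp: eventually_at_right_field flat_exp_def exp_minus field_simps intro!: exI[of _ 1])
    moreover have "((\<lambda>h. flat_exp k h / h) \<longlongrightarrow> 0) (at_left 0)"
      by (rule Lim_transform_eventually[OF tendsto_const])
        (auto simp: eventually_at_left_field flat_exp_def intro!: exI[of _ "-1"])
    ultimately have "((\<lambda>h. flat_exp k h / h) \<longlongrightarrow> 0) (at 0)"
      by (simp add: filterlim_at_split)
    then show ?thesis
      using 3 by (simp add: DERIV_def flat_exp_def)
  qed
qed

text \<open>An algebra of functions that is closed under directional derivatives and contains the bump
  function below, so that smoothness of the latter follows by coinduction.\<close>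

inductive_set bump_algebra :: "'a::euclidean_space \<Rightarrow> real \<Rightarrow> ('a \<Rightarrow> real) set" for a r where
  const: "(\<lambda>x. c) \<in> bump_algebra a r"
| inner: "(\<lambda>x. (x - a) \<bullet> v) \<in> bump_algebra a r"
| flat: "(\<lambda>x. flat_exp k (r\<^sup>2 - (x - a) \<bullet> (x - a))) \<in> bump_algebra a r"
| add: "f \<in> bump_algebra a r \<Longrightarrow> g \<in> bump_algebra a r \<Longrightarrow> (\<lambda>x. f x + g x) \<in> bump_algebra a r"
| mult: "f \<in> bump_algebra a r \<Longrightarrow> g \<in> bump_algebra a r \<Longrightarrow> (\<lambda>x. f x * g x) \<in> bump_algebra a r"

lemma bump_algebra_derivative:
  assumes "f \<in> bump_algebra a r"
  shows "\<exists>f'. (\<forall>x. (f has_derivative f' x) (at x)) \<and> (\<forall>v. (\<lambda>x. f' x v) \<in> bump_algebra a r)"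
  using assms
proof induction
  case (const c)
  show ?case
    by (rule exI[of _ "\<lambda>x v. 0"]) (auto intro: bump_algebra.const)
next
  case (inner w)
  show ?case
    by (rule exI[of _ "\<lambda>x v. v \<bullet> w"]) (auto intro!: bump_algebra.const derivative_eq_intros)
next
  case (flat k)
  let ?s = "\<lambda>x. r\<^sup>2 - (x - a) \<bullet> (x - a)"
  \<comment> \<open>Chain rule: \<open>?s\<close> has derivative
    \<open>-2 * ((x - a) \<bullet> v)\<close> in direction \<open>v\<close>. The formula uses only
    sums and products, never a difference, so that the introduction rules of
    \<open>bump_algebra\<close> match it.\<close>
  let ?f = "\<lambda>x v. (flat_exp (k + 2) (?s x) + (- real k) * flat_exp (k + 1) (?s x)) * ((-2) * ((x - a) \<bullet> v))"
  have "((\<lambda>x. flat_exp k (?s x)) has_derivative ?f x) (at x)" for x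
    by (rule has_derivative_eq_rhs[OF DERIV_compose_FDERIV[OF flat_exp_has_derivative]])
      (auto intro!: derivative_eq_intros simp: inner_commute algebra_simps)
  moreover have "(\<lambda>x. ?f x v) \<in> bump_algebra a r" for v
    by (intro bump_algebra.intros)
  ultimately show ?case
    by (intro exI[of _ ?f]) auto
next
  case (add f g)
  then obtain f' g' where
    "\<And>x. (f has_derivative f' x) (at x)" "\<And>v. (\<lambda>x. f' x v) \<in> bump_algebra a r"
    "\<And>x. (g has_derivative g' x) (at x)" "\<And>v. (\<lambda>x. g' x v) \<in> bump_algebra a r"
    by blast
  then show ?case
    by (intro exI[of _ "\<lambda>x v. f' x v + g' x v"]) (auto intro!: bump_algebra.add derivative_intros)
next
  case (mult f g)
  then obtain f' g' where
    "\<And>x. (f has_derivative f' x) (at x)" "\<And>v. (\<lambda>x. f' x v) \<in> bump_algebra a r"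
    "\<And>x. (g has_derivative g' x) (at x)" "\<And>v. (\<lambda>x. g' x v) \<in> bump_algebra a r"
    by blast
  then show ?case
    using mult.hyps
    by (intro exI[of _ "\<lambda>x v. f x * g' x v + f' x v * g x"])
      (auto intro!: bump_algebra.add bump_algebra.mult has_derivative_mult)
qed

text \<open>The argument of \<open>flat_exp 0\<close> is the squared radius minus the squared
  distance to \<open>a\<close>, which is positive exactly inside the ball.\<close>

lemma smooth_bump_exists:
  fixes a :: "'a::euclidean_space"
  assumes "r > 0"
  obtains \<phi> :: "'a \<Rightarrow> real" where "smooth_map \<phi>" "\<And>x. \<phi> x \<ge> 0" "\<phi> a > 0"
    "\<And>x. x \<notin> ball a r \<Longrightarrow> \<phi> x = 0"
proof
  let ?\<phi> = "\<lambda>x. flat_exp 0 (r\<^sup>2 - (x - a) \<bullet> (x - a))"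
  show "smooth_map ?\<phi>"
  proof (rule smooth_map_coinduct[where F = "bump_algebra a r"])
    show "g differentiable at x" if "g \<in> bump_algebra a r" for g x
      using bump_algebra_derivative[OF that] by (auto simp: differentiable_def)
    show "(\<lambda>x. frechet_derivative g (at x) v) \<in> bump_algebra a r" if g: "g \<in> bump_algebra a r" for g v
    proof -
      obtain g' where g': "\<And>x. (g has_derivative g' x) (at x)" "(\<lambda>x. g' x v) \<in> bump_algebra a r"
        using bump_algebra_derivative[OF g] by blast
      then show ?thesis
        using frechet_derivative_at[OF g'(1)] by simp
    qed
  qed (rule bump_algebra.flat)
  show "?\<phi> x \<ge> 0" for x
    by (simp add: flat_exp_def)
  show "?\<phi> a > 0"
    using assms by (simp add: flat_exp_def)
  show "?\<phi> x = 0" if "x \<notin> ball a r" for x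
  proof -
    have "r \<le> norm (x - a)"
      using that by (simp add: dist_norm norm_minus_commute)
    then have "r\<^sup>2 \<le> (x - a) \<bullet> (x - a)"
      using assms by (simp add: power_mono flip: power2_norm_eq_inner)
    then show ?thesis
      by (simp add: flat_exp_def)
  qed
qed

section \<open>Integration by parts and the fundamental lemma\<close>

lemma has_vector_derivative_along_line:
  assumes "(f has_derivative f') (at (x + t *\<^sub>R e))"
  shows "((\<lambda>s. f (x + s *\<^sub>R e)) has_vector_derivative f' e) (at t)"
proof -
  have "((\<lambda>s. x + s *\<^sub>R e) has_derivative (\<lambda>s. s *\<^sub>R e)) (at t)"
    by (auto intro!: derivative_eq_intros)
  from diff_chain_at[OF this assms] show ?thesis
    using has_derivative_linear[OF assms]
    by (simp add: o_def has_vector_derivative_def linear_scale)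
qed

lemma coord_deriv_eq:
  assumes "(f has_derivative f') (at x)"
  shows "coord_deriv \<mu> f x = f' (axis \<mu> 1)"
  unfolding coord_deriv_def
  by (rule vector_derivative_at, rule has_vector_derivative_along_line) (use assms in simp)

text \<open>The integral of the translate of \<open>f\<close> by \<open>t *\<^sub>R e\<close> does
  not depend on \<open>t\<close>, while its derivative at \<open>t = 0\<close> is the integral of
  \<open>f' x e\<close>. The margin \<open>norm e\<close> keeps the translated support inside the
  box for all \<open>t\<close> between -1 and 1.\<close>

lemma integral_directional_derivative_eq_0:
  fixes f :: "'a::euclidean_space \<Rightarrow> real"
  assumes der: "\<And>x. (f has_derivative f' x) (at x)"
    and cont: "continuous_on UNIV (\<lambda>x. f' x e)"
    and supp: "\<And>x. x \<notin> ball a r \<Longrightarrow> f x = 0"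
    and box: "cball a (r + norm e) \<subseteq> cbox u v"
  shows "integral (cbox u v) (\<lambda>x. f' x e) = 0"
proof -
  have f_cont: "continuous_on S f" for S
    using der by (meson continuous_at_imp_continuous_on has_derivative_continuous)
  \<comment> \<open>Every box around the support gives the same integral, so the original box may be
    exchanged for its translate.\<close>
  have int_UNIV: "(f has_integral integral (cbox p q) f) UNIV" if "ball a r \<subseteq> cbox p q" for p q
    by (rule has_integral_on_superset[OF integrable_integral[OF integrable_continuous[OF f_cont]]])
      (use that supp in blast)+
  have const: "integral (cbox u v) (\<lambda>x. f (x + t *\<^sub>R e)) = integral UNIV f" if "t \<in> {-1<..<1}" for t
  proof -
    have le: "norm (t *\<^sub>R e) \<le> norm e"
      using that by (auto intro!: mult_left_le_one_le)
    have "ball a r \<subseteq> cbox (u + t *\<^sub>R e) (v + t *\<^sub>R e)"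
    proof
      fix x assume x: "x \<in> ball a r"
      have "dist a (x - t *\<^sub>R e) \<le> dist a x + norm (t *\<^sub>R e)"
        using norm_triangle_ineq[of "a - x" "t *\<^sub>R e"] by (simp add: dist_norm algebra_simps)
      then have "x - t *\<^sub>R e \<in> cbox u v"
        using x le box by (auto simp: subset_iff)
      then show "x \<in> cbox (u + t *\<^sub>R e) (v + t *\<^sub>R e)"
        by (simp add: mem_box algebra_simps)
    qed
    from int_UNIV[OF this] show ?thesis
      using integral_shift_cbox_plus[of u v f "t *\<^sub>R e"]
      by (simp add: o_def add.commute integral_unique)
  qed
  have "((\<lambda>t. integral (cbox u v) (\<lambda>x. f (x + t *\<^sub>R e))) has_vector_derivative
      integral (cbox u v) (\<lambda>x. f' (x + 0 *\<^sub>R e) e)) (at 0 within {-1<..<1})"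
  proof (rule leibniz_rule_vector_derivative)
    show "((\<lambda>t. f (x + t *\<^sub>R e)) has_vector_derivative f' (x + t *\<^sub>R e) e) (at t within {-1<..<1})" for t x
      by (rule has_vector_derivative_at_within[OF has_vector_derivative_along_line[OF der]])
    show "(\<lambda>x. f (x + t *\<^sub>R e)) integrable_on cbox u v" for t
      by (intro integrable_continuous continuous_on_compose2[OF f_cont[of UNIV]] continuous_intros) auto
    show "continuous_on ({-1<..<1} \<times> cbox u v) (\<lambda>(t, x). f' (x + t *\<^sub>R e) e)"
      unfolding split_beta
      by (intro continuous_on_compose2[OF cont] continuous_intros) auto
  qed auto
  then have "((\<lambda>t. integral (cbox u v) (\<lambda>x. f (x + t *\<^sub>R e))) has_vector_derivative
      integral (cbox u v) (\<lambda>x. f' x e)) (at 0)"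
    using at_within_open[of "0::real" "{-1<..<1}"] by simp
  moreover have "((\<lambda>t. integral (cbox u v) (\<lambda>x. f (x + t *\<^sub>R e))) has_vector_derivative 0) (at 0)"
    by (rule has_vector_derivative_transform_within_open[where S = "{-1<..<1}"
          and f = "\<lambda>t. integral UNIV f"]) (auto simp: const)
  ultimately show ?thesis
    by (rule vector_derivative_unique_at)
qed

text \<open>A bump concentrated where \<open>g\<close> keeps its sign at \<open>a\<close> would give
  a nonzero integral. The margin 1 around the ball is the norm of a coordinate vector, which leaves
  room for integration by parts.\<close>

lemma fundamental_lemma_calculus_of_variations:
  fixes g :: "'a::euclidean_space \<Rightarrow> real"
  assumes cont: "continuous_on UNIV g"
    and int: "\<And>\<phi> r u v. smooth_map \<phi> \<Longrightarrow> (\<And>x. x \<notin> ball a r \<Longrightarrow> \<phi> x = 0) \<Longrightarrow>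
        cball a (r + 1) \<subseteq> cbox u v \<Longrightarrow> integral (cbox u v) (\<lambda>x. \<phi> x * g x) = 0"
  shows "g a = 0"
proof (rule ccontr)
  assume nz: "g a \<noteq> 0"
  obtain r where r: "r > 0" "\<And>x. x \<in> ball a r \<Longrightarrow> g x * g a > 0"
  proof -
    \<comment> \<open>Multiplying by the constant \<open>g a\<close> treats both signs of
      \<open>g a\<close> at once.\<close>
    have "continuous_on UNIV (\<lambda>x. g x * g a)"
      by (intro continuous_intros cont)
    then have "open ((\<lambda>x. g x * g a) -` {0<..})"
      by (intro open_vimage open_greaterThan)
    moreover have "a \<in> (\<lambda>x. g x * g a) -` {0<..}"
      using nz by (auto simp: zero_less_mult_iff)
    ultimately show ?thesis
      using that by (auto simp: open_contains_ball subset_iff)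
  qed
  obtain \<phi> :: "'a \<Rightarrow> real" where \<phi>: "smooth_map \<phi>" "\<And>x. \<phi> x \<ge> 0" "\<phi> a > 0"
    "\<And>x. x \<notin> ball a r \<Longrightarrow> \<phi> x = 0"
    using smooth_bump_exists[OF r(1)] by blast
  obtain w where w: "cball a (r + 1) \<subseteq> box (-w) w"
    using bounded_subset_box_symmetric bounded_cball by metis
  then have w': "cball a (r + 1) \<subseteq> cbox (-w) w"
    using box_subset_cbox by blast
  have a_mem: "a \<in> box (-w) w" "a \<in> cbox (-w) w"
    using w w' r(1) by auto
  let ?f = "\<lambda>x. \<phi> x * (g x * g a)"
  have f_cont: "continuous_on (cbox (-w) w) ?f"
    by (intro continuous_intros smooth_map_continuous_on \<phi> continuous_on_subset[OF cont]) auto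
  have "integral (cbox (-w) w) (\<lambda>x. (\<phi> x * g x) * g a) = 0"
    using int[OF \<phi>(1,4) w'] by simp
  then have "(?f has_integral 0) (cbox (-w) w)"
    using integrable_integral[OF integrable_continuous[OF f_cont]] by (simp add: mult.assoc)
  \<comment> \<open>A continuous nonnegative function whose integral over a nondegenerate box is 0
    vanishes on the box, in particular at \<open>a\<close>.\<close>
  moreover have "0 \<le> ?f x" for x
    using r(2)[of x] \<phi>(2)[of x] \<phi>(4)[of x] by (cases "x \<in> ball a r") auto
  ultimately have "?f a = 0"
    by (intro has_integral_0_cbox_imp_0[OF f_cont]) (use a_mem in auto)
  then show False
    using nz \<phi>(3) by simp
qed

section \<open>The first variation\<close>

text \<open>\<open>arg_val M\<close> and \<open>arg_grad \<mu> M\<close> are the directions in which the argument of the Lagrangian moves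
  when \<open>\<Psi>\<close>, respectively \<open>\<partial>\<^sub>\<mu>\<Psi>\<close>, is varied by \<open>M\<close>.\<close>

definition arg_val :: "complex^'c^'r \<Rightarrow> ('n::finite, 'r::finite, 'c::finite) lagr_arg" where
  "arg_val M = (M, conj_transpose M, 0, 0, 0)"

definition arg_grad :: "'n \<Rightarrow> complex^'c^'r \<Rightarrow> ('n::finite, 'r::finite, 'c::finite) lagr_arg" where
  "arg_grad \<mu> M = (0, 0, col_blocks (\<lambda>\<nu>. if \<nu> = \<mu> then M else 0),
     row_blocks (\<lambda>\<nu>. if \<nu> = \<mu> then conj_transpose M else 0), 0)"

definition arg_pos :: "real^'n \<Rightarrow> ('n::finite, 'r::finite, 'c::finite) lagr_arg" where
  "arg_pos x = (0, 0, 0, 0, x)"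

lemma conj_transpose_nth [simp]: "conj_transpose M $ i $ j = cnj (M $ j $ i)"
  by (simp add: conj_transpose_def transpose_def)

lemma bounded_linear_conj_transpose: "bounded_linear conj_transpose"
  by (intro linear_conv_bounded_linear[THEN iffD1] linearI)
    (simp_all add: vec_eq_iff complex_eq_iff)

lemma bounded_linear_arg_val: "bounded_linear arg_val"
  by (intro linear_conv_bounded_linear[THEN iffD1] linearI)
    (simp_all add: arg_val_def vec_eq_iff zero_prod_def)

lemma bounded_linear_arg_grad: "bounded_linear (arg_grad \<mu>)"
  by (intro linear_conv_bounded_linear[THEN iffD1] linearI)
    (simp_all add: arg_grad_def vec_eq_iff col_blocks_def row_blocks_def)

lemma bounded_linear_arg_pos: "bounded_linear arg_pos"
  by (intro linear_conv_bounded_linear[THEN iffD1] linearI) (simp_all add: arg_pos_def)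

section \<open>Coordinate derivatives, and the smooth dependence of the Lagrangian's argument on the
  position\<close>

lemma coord_deriv_smooth_map:
  assumes "smooth_map f"
  shows "coord_deriv \<mu> f = (\<lambda>x. frechet_derivative f (at x) (axis \<mu> 1))"
  using coord_deriv_eq[OF smooth_map_has_derivative[OF assms]] by (simp add: fun_eq_iff)

lemma smooth_map_coord_deriv: "smooth_map f \<Longrightarrow> smooth_map (coord_deriv \<mu> f)"
  by (simp add: coord_deriv_smooth_map smooth_map_frechet_derivative)

lemma coord_deriv_linear_image:
  assumes "bounded_linear T" "f differentiable at x"
  shows "coord_deriv \<mu> (\<lambda>x. T (f x)) x = T (coord_deriv \<mu> f x)"
proof -
  obtain f' where f': "(f has_derivative f') (at x)"
    using assms(2) by (auto simp: differentiable_def)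
  show ?thesis
    using coord_deriv_eq[OF f'] coord_deriv_eq[OF bounded_linear.has_derivative[OF assms(1) f']]
    by simp
qed

lemma coord_deriv_add_scaleR:
  assumes "f differentiable at x" "g differentiable at x"
  shows "coord_deriv \<mu> (\<lambda>x. f x + t *\<^sub>R g x) x = coord_deriv \<mu> f x + t *\<^sub>R coord_deriv \<mu> g x"
proof -
  obtain f' g' where "(f has_derivative f') (at x)" "(g has_derivative g') (at x)"
    using assms by (auto simp: differentiable_def)
  then show ?thesis
    using coord_deriv_eq[of "\<lambda>x. f x + t *\<^sub>R g x" "\<lambda>v. f' v + t *\<^sub>R g' v" x \<mu>]
    by (simp add: coord_deriv_eq has_derivative_add has_derivative_scaleR_right)
qed

lemma differentiable_vec:
  fixes f :: "'b::real_normed_vector \<Rightarrow> 'a::euclidean_space^'q"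
  assumes "\<And>i. (\<lambda>y. f y $ i) differentiable at x"
  shows "f differentiable at x"
  using assms
  unfolding differentiable_componentwise_within[of f] differentiable_componentwise_within[of "\<lambda>y. f y $ i" for i]
  by (auto simp: Basis_vec_def inner_axis)

lemma coord_deriv_component:
  fixes F :: "real^'n \<Rightarrow> 'a::euclidean_space^'q^'p"
  assumes "\<And>i j. (\<lambda>y. F y $ i $ j) differentiable at x"
  shows "coord_deriv \<mu> F x $ i $ j = coord_deriv \<mu> (\<lambda>y. F y $ i $ j) x"
proof -
  have "F differentiable at x"
    by (intro differentiable_vec assms)
  moreover have "bounded_linear (\<lambda>M::'a^'q^'p. M $ i $ j)"
    by (rule bounded_linear_compose[OF bounded_linear_vec_nth bounded_linear_vec_nth])
  ultimately show ?thesis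
    using coord_deriv_linear_image[of "\<lambda>M. M $ i $ j" F x \<mu>] by simp
qed

lemma smooth_map_differentiable: "smooth_map f \<Longrightarrow> f differentiable at x"
  using smooth_map_has_derivative by (auto simp: differentiable_def)

text \<open>Conjugate transposition is real linear and commutes with coordinate derivatives. The
  argument thus becomes a sum of linear images of \<open>\<Psi>\<close>, its derivatives and the
  position, from which smoothness and the effect of a variation can be read off.\<close>

lemma field_arg_eq:
  assumes "smooth_map \<Psi>"
  shows "field_arg \<Psi> x = arg_val (\<Psi> x) + (\<Sum>\<mu>\<in>UNIV. arg_grad \<mu> (coord_deriv \<mu> \<Psi> x)) + arg_pos x"
proof -
  have "coord_deriv \<mu> (\<lambda>y. conj_transpose (\<Psi> y)) x = conj_transpose (coord_deriv \<mu> \<Psi> x)" for \<mu>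
    by (rule coord_deriv_linear_image[OF bounded_linear_conj_transpose smooth_map_differentiable[OF assms]])
  then show ?thesis
    by (simp add: field_arg_def arg_val_def arg_grad_def arg_pos_def prod_eq_iff fst_sum snd_sum
        vec_eq_iff col_blocks_def row_blocks_def if_distrib if_distribR cong: if_cong)
qed

lemma smooth_map_field_arg:
  assumes "smooth_map \<Psi>"
  shows "smooth_map (field_arg \<Psi>)"
proof -
  have "smooth_map (\<lambda>x. arg_val (\<Psi> x) + (\<Sum>\<mu>\<in>UNIV. arg_grad \<mu> (coord_deriv \<mu> \<Psi> x)) + arg_pos x)"
    by (intro smooth_map_add smooth_map_sum smooth_map_linear smooth_map_coord_deriv assms
        smooth_map_linear_image[OF bounded_linear_arg_val]
        smooth_map_linear_image[OF bounded_linear_arg_grad] bounded_linear_arg_pos)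
  then show ?thesis
    by (simp add: field_arg_eq[OF assms, abs_def])
qed

section \<open>Derivatives of the Lagrangian along a field\<close>

definition field_deriv ::
  "(('n::finite, 'r::finite, 'c::finite) lagr_arg \<Rightarrow> complex) \<Rightarrow> (real^'n \<Rightarrow> complex^'c^'r)
    \<Rightarrow> ('n, 'r, 'c) lagr_arg \<Rightarrow> real^'n \<Rightarrow> complex" where
  "field_deriv L \<Psi> u x = frechet_derivative L (at (field_arg \<Psi> x)) u"

text \<open>The Euler-Lagrange operator paired with a constant variation \<open>M\<close>. It is a
  common form for all three systems: suitable one-entry matrices \<open>M\<close> give the entries
  of the real system directly and combinations of the entries of the two complex ones.\<close>

definition euler_lagrange ::
  "(('n::finite, 'r::finite, 'c::finite) lagr_arg \<Rightarrow> complex) \<Rightarrow> (real^'n \<Rightarrow> complex^'c^'r)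
    \<Rightarrow> complex^'c^'r \<Rightarrow> real^'n \<Rightarrow> complex" where
  "euler_lagrange L \<Psi> M x = field_deriv L \<Psi> (arg_val M) x
     - (\<Sum>\<mu>\<in>UNIV. coord_deriv \<mu> (field_deriv L \<Psi> (arg_grad \<mu> M)) x)"

lemma linear_field_deriv:
  assumes "smooth_map L"
  shows "linear (\<lambda>u. field_deriv L \<Psi> u x)"
  unfolding field_deriv_def
  using smooth_map_has_derivative[OF assms] has_derivative_linear by blast

lemma field_deriv_has_derivative:
  assumes L: "smooth_map L" and \<Psi>: "smooth_map \<Psi>"
  shows "(field_deriv L \<Psi> u has_derivative
      (\<lambda>v. frechet_derivative (\<lambda>p. frechet_derivative L (at p) u) (at (field_arg \<Psi> x))
             (frechet_derivative (field_arg \<Psi>) (at x) v))) (at x)"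
  using diff_chain_at[OF smooth_map_has_derivative[OF smooth_map_field_arg[OF \<Psi>]]
      smooth_map_has_derivative[OF smooth_map_frechet_derivative[OF L]]]
  by (simp add: o_def field_deriv_def[abs_def])

lemma field_deriv_differentiable:
  "smooth_map L \<Longrightarrow> smooth_map \<Psi> \<Longrightarrow> field_deriv L \<Psi> u differentiable at x"
  using field_deriv_has_derivative by (metis differentiable_def)

lemma continuous_on_field_deriv:
  "smooth_map L \<Longrightarrow> smooth_map \<Psi> \<Longrightarrow> continuous_on S (field_deriv L \<Psi> u)"
  by (meson continuous_at_imp_continuous_on differentiable_imp_continuous_within field_deriv_differentiable)

text \<open>By the chain rule this is a second derivative of \<open>L\<close>, taken at a point and
  in a direction that both depend continuously on the position.\<close>

lemma continuous_on_coord_deriv_field_deriv: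
  assumes L: "smooth_map L" and \<Psi>: "smooth_map \<Psi>"
  shows "continuous_on S (coord_deriv \<mu> (field_deriv L \<Psi> u))"
  unfolding coord_deriv_eq[OF field_deriv_has_derivative[OF L \<Psi>], abs_def]
  by (intro continuous_on_frechet_derivative_compose smooth_map_frechet_derivative L
      smooth_map_continuous_on smooth_map_field_arg \<Psi>)

section \<open>Differentiating the functional along a variation\<close>

text \<open>Apart from the position, the argument is real linear in the field, so a variation moves
  it along a straight line in \<open>t\<close>. By the product rule with \<open>M\<close> constant,
  the gradient slots move by the derivatives of \<open>\<phi>\<close>.\<close>

lemma field_arg_variation:
  fixes \<Psi> :: "real^'n::finite \<Rightarrow> complex^'c::finite^'r::finite"
  assumes "smooth_map \<Psi>" "smooth_map \<phi>"
  shows "field_arg (\<lambda>y. \<Psi> y + (t * \<phi> y) *\<^sub>R M) x = field_arg \<Psi> x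
      + t *\<^sub>R (\<phi> x *\<^sub>R arg_val M + (\<Sum>\<mu>\<in>UNIV. coord_deriv \<mu> \<phi> x *\<^sub>R arg_grad \<mu> M))"
proof -
  note lin = bounded_linear.linear[OF bounded_linear_arg_val]
    bounded_linear.linear[OF bounded_linear_arg_grad]
  have bl: "bounded_linear (\<lambda>s. s *\<^sub>R M)"
    by (rule bounded_linear_scaleR_left)
  have H: "smooth_map (\<lambda>y. \<phi> y *\<^sub>R M)"
    by (rule smooth_map_linear_image[OF bl assms(2)])
  have eq: "(\<lambda>y. \<Psi> y + (t * \<phi> y) *\<^sub>R M) = (\<lambda>y. \<Psi> y + t *\<^sub>R (\<phi> y *\<^sub>R M))"
    by simp
  have smooth: "smooth_map (\<lambda>y. \<Psi> y + t *\<^sub>R (\<phi> y *\<^sub>R M))"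
    by (intro smooth_map_add assms(1) smooth_map_linear_image[OF bounded_linear_scaleR_right] H)
  have cd: "coord_deriv \<mu> (\<lambda>y. \<Psi> y + t *\<^sub>R (\<phi> y *\<^sub>R M)) x
      = coord_deriv \<mu> \<Psi> x + t *\<^sub>R (coord_deriv \<mu> \<phi> x *\<^sub>R M)" for \<mu>
    using coord_deriv_add_scaleR[OF smooth_map_differentiable[OF assms(1)] smooth_map_differentiable[OF H]]
      coord_deriv_linear_image[OF bl smooth_map_differentiable[OF assms(2)]]
    by simp
  show ?thesis
    unfolding eq
    by (simp only: field_arg_eq[OF smooth] field_arg_eq[OF assms(1)] cd linear_add[OF lin(1)]
        linear_add[OF lin(2)] linear_scale[OF lin(1)] linear_scale[OF lin(2)] sum.distrib
        scaleR_add_right scaleR_sum_right add_ac)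
qed

text \<open>Along the varied fields the imaginary part of the functional is constantly 0, hence so
  is its derivative at \<open>t = 0\<close>, which is the integral stated here.\<close>

lemma first_variation:
  fixes \<Psi> :: "real^'n::finite \<Rightarrow> complex^'c::finite^'r::finite"
  assumes L: "smooth_map L" and adm: "admissible_space L \<S>"
    and real: "\<forall>\<Phi>\<in>\<S>. lagrangian_functional L \<Phi> \<in> \<real>" and mem: "\<Psi> \<in> \<S>"
    and \<phi>: "smooth_map \<phi>" "\<And>x. x \<notin> ball a r \<Longrightarrow> \<phi> x = 0" and box: "cball a r \<subseteq> cbox u v"
  shows "integral (cbox u v) (\<lambda>x. \<phi> x * Im (field_deriv L \<Psi> (arg_val M) x)
      + (\<Sum>\<mu>\<in>UNIV. coord_deriv \<mu> \<phi> x * Im (field_deriv L \<Psi> (arg_grad \<mu> M) x))) = 0"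
proof -
  have \<Psi>: "smooth_map \<Psi>"
    using adm mem by (simp add: admissible_space_def)
  define w :: "real^'n \<Rightarrow> ('n, 'r, 'c) lagr_arg"
    where "w = (\<lambda>x. \<phi> x *\<^sub>R arg_val M + (\<Sum>\<mu>\<in>UNIV. coord_deriv \<mu> \<phi> x *\<^sub>R arg_grad \<mu> M))"
  define \<Phi> where "\<Phi> t = (\<lambda>y. \<Psi> y + (t * \<phi> y) *\<^sub>R M)" for t
  have density: "lagrangian_density L (\<Phi> t) x = L (field_arg \<Psi> x + t *\<^sub>R w x)" for t x
    unfolding lagrangian_density_def \<Phi>_def w_def field_arg_variation[OF \<Psi> \<phi>(1)] ..
  have \<Phi>_mem: "\<Phi> t \<in> \<S>" for t
  proof -
    have "smooth_map (\<lambda>y. t *\<^sub>R \<phi> y *\<^sub>R M)"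
      by (intro smooth_map_linear_image[OF bounded_linear_scaleR_right]
          smooth_map_linear_image[OF bounded_linear_scaleR_left] \<phi>)
    moreover have "{y. t *\<^sub>R \<phi> y *\<^sub>R M \<noteq> 0} \<subseteq> cball a r"
    proof -
      have "\<phi> y = 0" if "y \<notin> cball a r" for y
        using that \<phi>(2) ball_subset_cball by blast
      then show ?thesis
        by (metis (mono_tags, lifting) mem_Collect_eq scaleR_zero_left scaleR_zero_right subsetI)
    qed
    then have "compact (closure {y. t *\<^sub>R \<phi> y *\<^sub>R M \<noteq> 0})"
      using bounded_subset[OF bounded_cball] by (simp add: compact_closure)
    ultimately have "(\<lambda>y. \<Psi> y + t *\<^sub>R \<phi> y *\<^sub>R M) \<in> \<S>"
      using adm mem by (simp add: admissible_space_def)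
    then show ?thesis
      by (simp add: \<Phi>_def)
  qed
  \<comment> \<open>The closed ball is used because its complement is open: \<open>\<phi>\<close>
    vanishes near such a point, so its derivative does too.\<close>
  have \<phi>_deriv: "coord_deriv \<mu> \<phi> x = 0" if "x \<notin> cball a r" for x \<mu>
  proof -
    have "(\<phi> has_derivative (\<lambda>v. 0)) (at x)"
      by (rule has_derivative_transform_within_open[of "\<lambda>x. 0" _ _ _ "- cball a r"])
        (use that \<phi>(2) ball_subset_cball in auto)
    then show ?thesis
      by (rule coord_deriv_eq)
  qed
  have w_supp: "w x = 0" if "x \<notin> cball a r" for x
    using that \<phi>(2)[of x] \<phi>_deriv[OF that] by (simp add: w_def)
  have cont_L: "continuous_on UNIV L"
    by (rule smooth_map_continuous_on[OF L])
  have cont_fa: "continuous_on S (field_arg \<Psi>)" for S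
    by (rule smooth_map_continuous_on[OF smooth_map_field_arg[OF \<Psi>]])
  have cont_w: "continuous_on S w" for S
    unfolding w_def
    by (intro continuous_intros smooth_map_continuous_on smooth_map_coord_deriv \<phi>)
  define d where "d t x = Im (L (field_arg \<Psi> x + t *\<^sub>R w x)) - Im (L (field_arg \<Psi> x))" for t x
  have cont_d: "continuous_on (cbox u v) (d t)" for t
    unfolding d_def
    by (intro continuous_intros continuous_on_compose2[OF cont_L] cont_fa cont_w) auto
  \<comment> \<open>Over the whole space the imaginary parts of both densities integrate to 0.
    Outside the box \<open>w\<close> is 0, hence so is \<open>d t\<close>, and the box integral is
    the whole-space integral.\<close>
  have const: "integral (cbox u v) (d t) = 0" for t
  proof -
    have int: "integrable lborel (lagrangian_density L (\<Phi> t))" for t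
      using adm \<Phi>_mem by (simp add: admissible_space_def)
    have Im_int: "(\<integral>x. Im (lagrangian_density L (\<Phi> t) x) \<partial>lborel) = 0" for t
      using real \<Phi>_mem[of t] int[of t]
      by (simp add: lagrangian_functional_def complex_is_Real_iff)
    have "\<Phi> 0 = \<Psi>"
      by (simp add: \<Phi>_def)
    then have d_eq: "d t = (\<lambda>x. Im (lagrangian_density L (\<Phi> t) x) - Im (lagrangian_density L (\<Phi> 0) x))"
      by (simp add: d_def density fun_eq_iff)
    have "integrable lborel (d t)" "(\<integral>x. d t x \<partial>lborel) = 0"
      unfolding d_eq using int Im_int by (simp_all add: integrable_Im)
    then have "(d t has_integral 0) UNIV"
      using has_integral_integral_lborel by metis
    moreover have "(d t has_integral integral (cbox u v) (d t)) UNIV"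
    proof (rule has_integral_on_superset[OF integrable_integral[OF integrable_continuous[OF cont_d]]])
      show "d t x = 0" if "x \<notin> cbox u v" for x
      proof -
        have "w x = 0"
          using w_supp that box by blast
        then show ?thesis
          by (simp add: d_def)
      qed
    qed simp
    ultimately show ?thesis
      using has_integral_unique by blast
  qed
  have "((\<lambda>t. integral (cbox u v) (d t)) has_vector_derivative
      integral (cbox u v) (\<lambda>x. Im (frechet_derivative L (at (field_arg \<Psi> x + 0 *\<^sub>R w x)) (w x)))) (at 0 within UNIV)"
  proof (rule leibniz_rule_vector_derivative)
    show "((\<lambda>t. d t x) has_vector_derivative
        Im (frechet_derivative L (at (field_arg \<Psi> x + t *\<^sub>R w x)) (w x))) (at t within UNIV)" for t x
    proof -
      have "((\<lambda>t. L (field_arg \<Psi> x + t *\<^sub>R w x)) has_vector_derivative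
          frechet_derivative L (at (field_arg \<Psi> x + t *\<^sub>R w x)) (w x)) (at t)"
        by (rule has_vector_derivative_along_line[OF smooth_map_has_derivative[OF L]])
      from bounded_linear.has_vector_derivative[OF bounded_linear_Im this] show ?thesis
        unfolding d_def by (auto intro!: derivative_eq_intros)
    qed
    show "d t integrable_on cbox u v" for t
      by (rule integrable_continuous[OF cont_d])
    have "continuous_on (UNIV \<times> cbox u v) (\<lambda>p. frechet_derivative L
        (at (field_arg \<Psi> (snd p) + fst p *\<^sub>R w (snd p))) (w (snd p)))"
      by (intro continuous_on_frechet_derivative_compose[OF L] continuous_intros
          continuous_on_compose2[OF cont_fa[of UNIV]] continuous_on_compose2[OF cont_w[of UNIV]]) auto
    then show "continuous_on (UNIV \<times> cbox u v)
        (\<lambda>(t, x). Im (frechet_derivative L (at (field_arg \<Psi> x + t *\<^sub>R w x)) (w x)))"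
      unfolding split_beta by (rule continuous_on_Im)
  qed auto
  then have "((\<lambda>t. 0) has_vector_derivative
      integral (cbox u v) (\<lambda>x. Im (field_deriv L \<Psi> (w x) x))) (at (0::real))"
    by (simp add: const field_deriv_def)
  then have "integral (cbox u v) (\<lambda>x. Im (field_deriv L \<Psi> (w x) x)) = 0"
    using vector_derivative_unique_at has_vector_derivative_const by blast
  moreover note lin = linear_field_deriv[OF L]
  have "Im (field_deriv L \<Psi> (w x) x) = \<phi> x * Im (field_deriv L \<Psi> (arg_val M) x)
      + (\<Sum>\<mu>\<in>UNIV. coord_deriv \<mu> \<phi> x * Im (field_deriv L \<Psi> (arg_grad \<mu> M) x))" for x
    unfolding w_def linear_add[OF lin] linear_sum[OF lin] linear_scale[OF lin] by simp
  ultimately show ?thesis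
    by simp
qed

text \<open>Integration by parts moves the derivatives in the first variation from
  \<open>\<phi>\<close> to the Lagrangian; the fundamental lemma then removes
  \<open>\<phi>\<close>.\<close>

lemma euler_lagrange_real:
  fixes \<Psi> :: "real^'n::finite \<Rightarrow> complex^'c::finite^'r::finite"
  assumes L: "smooth_map L" and adm: "admissible_space L \<S>"
    and real: "\<forall>\<Phi>\<in>\<S>. lagrangian_functional L \<Phi> \<in> \<real>" and mem: "\<Psi> \<in> \<S>"
  shows "Im (euler_lagrange L \<Psi> M a) = 0"
proof (rule fundamental_lemma_calculus_of_variations[where g = "\<lambda>x. Im (euler_lagrange L \<Psi> M x)"])
  have \<Psi>: "smooth_map \<Psi>"
    using adm mem by (simp add: admissible_space_def)
  note cont = continuous_on_field_deriv[OF L \<Psi>] continuous_on_coord_deriv_field_deriv[OF L \<Psi>]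
  show "continuous_on UNIV (\<lambda>x. Im (euler_lagrange L \<Psi> M x))"
    unfolding euler_lagrange_def by (intro continuous_intros cont)
  fix \<phi> :: "real^'n \<Rightarrow> real" and r u v
  assume \<phi>: "smooth_map \<phi>" "\<And>x. x \<notin> ball a r \<Longrightarrow> \<phi> x = 0" and box: "cball a (r + 1) \<subseteq> cbox u v"
  let ?g = "\<lambda>\<mu>. field_deriv L \<Psi> (arg_grad \<mu> M)"
  \<comment> \<open>\<open>p \<mu>\<close> is the derivative of the compactly supported product
    \<open>\<phi> * Im (?g \<mu>)\<close> along axis \<open>\<mu>\<close>, so its integral vanishes;
    \<open>q\<close> is the integrand of the first variation.\<close>
  define p where "p \<mu> x = coord_deriv \<mu> \<phi> x * Im (?g \<mu> x) + \<phi> x * Im (coord_deriv \<mu> (?g \<mu>) x)" for \<mu> x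
  define q where "q x = \<phi> x * Im (field_deriv L \<Psi> (arg_val M) x)
      + (\<Sum>\<mu>\<in>UNIV. coord_deriv \<mu> \<phi> x * Im (?g \<mu> x))" for x
  have cont_\<phi>: "continuous_on S \<phi>" "continuous_on S (coord_deriv \<mu> \<phi>)" for S \<mu>
    by (intro smooth_map_continuous_on smooth_map_coord_deriv \<phi>)+
  have p_cont: "continuous_on S (p \<mu>)" for S \<mu>
    unfolding p_def by (intro continuous_intros cont cont_\<phi>)
  have q_cont: "continuous_on S q" for S
    unfolding q_def by (intro continuous_intros cont cont_\<phi>)
  have p_int: "integral (cbox u v) (p \<mu>) = 0" for \<mu>
  proof -
    define D where "D x e = \<phi> x * Im (frechet_derivative (?g \<mu>) (at x) e)
        + frechet_derivative \<phi> (at x) e * Im (?g \<mu> x)" for x e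
    have g_deriv: "(?g \<mu> has_derivative frechet_derivative (?g \<mu>) (at x)) (at x)" for x
      using field_deriv_differentiable[OF L \<Psi>] by (simp flip: frechet_derivative_works)
    have D: "((\<lambda>x. \<phi> x * Im (?g \<mu> x)) has_derivative D x) (at x)" for x
      unfolding D_def
      by (intro has_derivative_mult smooth_map_has_derivative \<phi> has_derivative_Im g_deriv)
    have p_eq: "p \<mu> = (\<lambda>x. D x (axis \<mu> 1))"
      by (simp add: fun_eq_iff p_def D_def coord_deriv_eq[OF g_deriv]
          coord_deriv_eq[OF smooth_map_has_derivative[OF \<phi>(1)]])
    show ?thesis
      unfolding p_eq
      by (rule integral_directional_derivative_eq_0[OF D])
        (use p_cont[of UNIV \<mu>] \<phi>(2) box in \<open>auto simp: p_eq\<close>)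
  qed
  \<comment> \<open>The terms that contain a derivative of \<open>\<phi>\<close> cancel between
    \<open>q\<close> and the \<open>p \<mu>\<close>.\<close>
  have "(\<lambda>x. \<phi> x * Im (euler_lagrange L \<Psi> M x)) = (\<lambda>x. q x - (\<Sum>\<mu>\<in>UNIV. p \<mu> x))"
    by (simp add: fun_eq_iff euler_lagrange_def p_def q_def sum.distrib algebra_simps sum_distrib_left)
  moreover have "integral (cbox u v) (\<lambda>x. q x - (\<Sum>\<mu>\<in>UNIV. p \<mu> x)) =
      integral (cbox u v) q - (\<Sum>\<mu>\<in>UNIV. integral (cbox u v) (p \<mu>))"
    by (subst integral_diff) (auto intro!: integrable_continuous q_cont p_cont continuous_intros integral_sum)
  moreover have "cball a r \<subseteq> cbox u v"
    using box subset_cball[of r "r + 1" a] by auto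
  then have "integral (cbox u v) q = 0"
    using first_variation[OF L adm real mem \<phi>] by (simp add: q_def[abs_def])
  ultimately show "integral (cbox u v) (\<lambda>x. \<phi> x * Im (euler_lagrange L \<Psi> M x)) = 0"
    by (simp add: p_int)
qed

section \<open>The Euler--Lagrange expressions in matrix entries\<close>

definition single_entry :: "'p::finite \<Rightarrow> 'q::finite \<Rightarrow> complex \<Rightarrow> complex^'q^'p" where
  "single_entry i j z = (\<chi> k l. if k = i \<and> l = j then z else 0)"

text \<open>Value and gradient are independent parameters here, because the real partial derivatives
  vary one of them while the other stays fixed.\<close>

definition arg_field ::
  "complex^'c^'r \<Rightarrow> ('n \<Rightarrow> complex^'c^'r) \<Rightarrow> real^'n \<Rightarrow> ('n::finite, 'r::finite, 'c::finite) lagr_arg" where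
  "arg_field M Ms x =
     (M, conj_transpose M, col_blocks Ms, row_blocks (\<lambda>\<mu>. conj_transpose (Ms \<mu>)), x)"

lemma arg_field_add_val: "arg_field (M + t *\<^sub>R K) Ms x = arg_field M Ms x + t *\<^sub>R arg_val K"
  by (simp add: arg_field_def arg_val_def vec_eq_iff complex_eq_iff)

lemma arg_field_add_grad:
  "arg_field M (Ms(\<mu> := Ms \<mu> + t *\<^sub>R K)) x = arg_field M Ms x + t *\<^sub>R arg_grad \<mu> K"
  by (simp add: arg_field_def arg_grad_def vec_eq_iff complex_eq_iff col_blocks_def row_blocks_def)

lemma field_arg_eq_arg_field:
  assumes "smooth_map \<Psi>"
  shows "field_arg \<Psi> x = arg_field (\<Psi> x) (\<lambda>\<mu>. coord_deriv \<mu> \<Psi> x) x"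
  by (simp add: field_arg_def arg_field_def
      coord_deriv_linear_image[OF bounded_linear_conj_transpose smooth_map_differentiable[OF assms]])

lemma real_lagrangian_eq:
  "real_lagrangian L X Y Xs Ys x
     = L (arg_field (complex_matrix X Y) (\<lambda>\<mu>. complex_matrix (Xs \<mu>) (Ys \<mu>)) x)"
proof -
  have "complex_matrix (transpose X) (- transpose Y) = conj_transpose (complex_matrix X Y)"
    for X Y :: "real^'a^'b"
    by (simp add: vec_eq_iff complex_matrix_def transpose_def complex_eq_iff)
  then show ?thesis
    by (simp add: real_lagrangian_def arg_field_def)
qed

lemma complex_matrix_update_Re:
  "complex_matrix (update_entry X i j t) Y
     = complex_matrix X Y + (t - X $ i $ j) *\<^sub>R single_entry i j 1"
  by (simp add: vec_eq_iff complex_matrix_def update_entry_def single_entry_def complex_eq_iff)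

lemma complex_matrix_update_Im:
  "complex_matrix X (update_entry Y i j t)
     = complex_matrix X Y + (t - Y $ i $ j) *\<^sub>R single_entry i j \<i>"
  by (simp add: vec_eq_iff complex_matrix_def update_entry_def single_entry_def complex_eq_iff)

lemma complex_matrix_Re_Im: "complex_matrix (Re_part \<Psi> x) (Im_part \<Psi> x) = \<Psi> x"
  by (simp add: vec_eq_iff complex_matrix_def Re_part_def Im_part_def)

lemma complex_matrix_coord_deriv:
  fixes \<Psi> :: "real^'n::finite \<Rightarrow> complex^'c::finite^'r::finite"
  assumes "smooth_map \<Psi>"
  shows "complex_matrix (coord_deriv \<mu> (Re_part \<Psi>) x) (coord_deriv \<mu> (Im_part \<Psi>) x) = coord_deriv \<mu> \<Psi> x"
proof -
  have "bounded_linear (map_matrix Re :: complex^'c^'r \<Rightarrow> _)" "bounded_linear (map_matrix Im :: complex^'c^'r \<Rightarrow> _)"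
    by (intro linear_conv_bounded_linear[THEN iffD1] linearI; simp add: vec_eq_iff)+
  then have "coord_deriv \<mu> (Re_part \<Psi>) x = map_matrix Re (coord_deriv \<mu> \<Psi> x)"
    "coord_deriv \<mu> (Im_part \<Psi>) x = map_matrix Im (coord_deriv \<mu> \<Psi> x)"
    using coord_deriv_linear_image[OF _ smooth_map_differentiable[OF assms]]
    by (simp_all add: Re_part_def[abs_def] Im_part_def[abs_def])
  then show ?thesis
    by (simp add: vec_eq_iff complex_matrix_def)
qed

text \<open>The shift by \<open>s\<close> is the form in which \<open>update_entry\<close> moves an
  entry: the partial derivative is taken at the current value of the entry, not at 0.\<close>

lemma vector_derivative_shifted_line:
  assumes "smooth_map L"
  shows "vector_derivative (\<lambda>t. L (p + (t - s) *\<^sub>R u)) (at s) = frechet_derivative L (at p) u"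
proof -
  have "(L has_derivative frechet_derivative L (at p)) (at ((p - s *\<^sub>R u) + s *\<^sub>R u))"
    using smooth_map_has_derivative[OF assms] by simp
  from has_vector_derivative_along_line[OF this] show ?thesis
    by (intro vector_derivative_at) (simp add: algebra_simps)
qed

text \<open>Changing one real entry moves the argument along a line whose direction is built from a
  one-entry matrix, with entry 1 for the real part and \<open>\<i>\<close> for the imaginary part.
  The swapped indices reflect the transposing derivative convention.\<close>

lemma
  fixes \<Psi> :: "real^'n::finite \<Rightarrow> complex^'c::finite^'r::finite"
  assumes L: "smooth_map L" and \<Psi>: "smooth_map \<Psi>"
  shows dL_Re_nth: "dL_Re L \<Psi> x $ j $ i = field_deriv L \<Psi> (arg_val (single_entry i j 1)) x"
    and dL_Im_nth: "dL_Im L \<Psi> x $ j $ i = field_deriv L \<Psi> (arg_val (single_entry i j \<i>)) x"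
    and dL_Re_mu_nth: "dL_Re_mu L \<Psi> \<mu> x $ j $ i = field_deriv L \<Psi> (arg_grad \<mu> (single_entry i j 1)) x"
    and dL_Im_mu_nth: "dL_Im_mu L \<Psi> \<mu> x $ j $ i = field_deriv L \<Psi> (arg_grad \<mu> (single_entry i j \<i>)) x"
proof -
  let ?M = "\<Psi> x" and ?Ms = "\<lambda>\<mu>. coord_deriv \<mu> \<Psi> x"
  note cm = complex_matrix_Re_Im complex_matrix_coord_deriv[OF \<Psi>]
  have upd_Re: "(\<lambda>\<nu>. complex_matrix (((\<lambda>\<nu>. coord_deriv \<nu> (Re_part \<Psi>) x)(\<mu> :=
        update_entry (coord_deriv \<mu> (Re_part \<Psi>) x) i j t)) \<nu>) (coord_deriv \<nu> (Im_part \<Psi>) x))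
      = ?Ms(\<mu> := ?Ms \<mu> + (t - coord_deriv \<mu> (Re_part \<Psi>) x $ i $ j) *\<^sub>R single_entry i j 1)" for t
    by (auto simp: fun_eq_iff cm complex_matrix_update_Re)
  have upd_Im: "(\<lambda>\<nu>. complex_matrix (coord_deriv \<nu> (Re_part \<Psi>) x) (((\<lambda>\<nu>. coord_deriv \<nu> (Im_part \<Psi>) x)(\<mu> :=
        update_entry (coord_deriv \<mu> (Im_part \<Psi>) x) i j t)) \<nu>))
      = ?Ms(\<mu> := ?Ms \<mu> + (t - coord_deriv \<mu> (Im_part \<Psi>) x $ i $ j) *\<^sub>R single_entry i j \<i>)" for t
    by (auto simp: fun_eq_iff cm complex_matrix_update_Im)
  note simps = real_matrix_deriv_def real_lagrangian_eq field_deriv_def field_arg_eq_arg_field[OF \<Psi>]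
    vector_derivative_shifted_line[OF L]
  show "dL_Re L \<Psi> x $ j $ i = field_deriv L \<Psi> (arg_val (single_entry i j 1)) x"
    by (simp add: dL_Re_def simps complex_matrix_update_Re cm arg_field_add_val)
  show "dL_Im L \<Psi> x $ j $ i = field_deriv L \<Psi> (arg_val (single_entry i j \<i>)) x"
    by (simp add: dL_Im_def simps complex_matrix_update_Im cm arg_field_add_val)
  \<comment> \<open>Function updates must stay unevaluated here and in the next claim, so that
    \<open>arg_field_add_grad\<close> can match them.\<close>
  show "dL_Re_mu L \<Psi> \<mu> x $ j $ i = field_deriv L \<Psi> (arg_grad \<mu> (single_entry i j 1)) x"
    by (simp add: dL_Re_mu_def simps upd_Re cm arg_field_add_grad[where Ms = ?Ms] del: fun_upd_apply)
  show "dL_Im_mu L \<Psi> \<mu> x $ j $ i = field_deriv L \<Psi> (arg_grad \<mu> (single_entry i j \<i>)) x"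
    by (simp add: dL_Im_mu_def simps upd_Im cm arg_field_add_grad[where Ms = ?Ms] del: fun_upd_apply)
qed

section \<open>Complex derivatives of the Lagrangian\<close>

text \<open>Holomorphy supplies a complex linear derivative with the position held fixed. By
  uniqueness of derivatives it is the restriction of the full derivative to directions with position
  component 0.\<close>

lemma frechet_derivative_complex_linear:
  fixes L :: "('n::finite, 'r::finite, 'c::finite) lagr_arg \<Rightarrow> complex"
  assumes L: "smooth_map L" and hol: "holomorphic_in_matrices L"
  shows "frechet_derivative L (at p)
      (map_matrix ((*) z) A, map_matrix ((*) z) B, map_matrix ((*) z) C, map_matrix ((*) z) E, 0)
    = z * frechet_derivative L (at p) (A, B, C, E, 0)"
proof -
  obtain P Q R S x where p: "p = (P, Q, R, S, x)"
    by (metis prod_cases5)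
  obtain D where D: "((\<lambda>(P, Q, R, S). L (P, Q, R, S, x)) has_derivative D) (at (P, Q, R, S))"
      "\<And>z A B C E. D (map_matrix ((*) z) A, map_matrix ((*) z) B, map_matrix ((*) z) C, map_matrix ((*) z) E)
        = z * D (A, B, C, E)"
    using hol unfolding holomorphic_in_matrices_def by blast
  let ?emb = "\<lambda>q::(complex^'c^'r) \<times> (complex^'r^'c) \<times> (complex^'c^('n \<times> 'r)) \<times> (complex^('n \<times> 'r)^'c).
    (fst q, fst (snd q), fst (snd (snd q)), snd (snd (snd q)), x)"
  have "(?emb has_derivative (\<lambda>q. (fst q, fst (snd q), fst (snd (snd q)), snd (snd (snd q)), 0)))
      (at (P, Q, R, S))"
    by (intro has_derivative_Pair has_derivative_fst has_derivative_snd has_derivative_ident has_derivative_const)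
  moreover have "(L has_derivative frechet_derivative L (at p)) (at (?emb (P, Q, R, S)))"
    using smooth_map_has_derivative[OF L] p by simp
  ultimately have L_emb: "((\<lambda>q. L (?emb q)) has_derivative (\<lambda>q. frechet_derivative L (at p)
      (fst q, fst (snd q), fst (snd (snd q)), snd (snd (snd q)), 0))) (at (P, Q, R, S))"
    using diff_chain_at by (fastforce simp: o_def)
  have "(\<lambda>(P, Q, R, S). L (P, Q, R, S, x)) = (\<lambda>q. L (?emb q))"
    by (simp add: fun_eq_iff)
  then have "((\<lambda>q. L (?emb q)) has_derivative D) (at (P, Q, R, S))"
    using D(1) by simp
  from has_derivative_unique[OF this L_emb] have "D = (\<lambda>q. frechet_derivative L (at p)
      (fst q, fst (snd q), fst (snd (snd q)), snd (snd (snd q)), 0))" .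
  then show ?thesis
    using D(2)[of z A B C E] by simp
qed

text \<open>The real derivative along the complex line is multiplication by a complex number, by
  complex linearity, and that number is therefore the complex derivative.\<close>

lemma deriv_complex_line:
  fixes L :: "('n::finite, 'r::finite, 'c::finite) lagr_arg \<Rightarrow> complex"
  assumes L: "smooth_map L" and hol: "holomorphic_in_matrices L"
  shows "deriv (\<lambda>z. L (p + (map_matrix ((*) (z - w)) A, map_matrix ((*) (z - w)) B,
      map_matrix ((*) (z - w)) C, map_matrix ((*) (z - w)) E, 0))) w
    = frechet_derivative L (at p) (A, B, C, E, 0)"
proof -
  let ?T = "\<lambda>z::complex. (map_matrix ((*) z) A, map_matrix ((*) z) B,
      map_matrix ((*) z) C, map_matrix ((*) z) E, 0 :: real^'n)"
  have T: "bounded_linear ?T"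
    by (intro linear_conv_bounded_linear[THEN iffD1] linearI)
      (simp_all add: vec_eq_iff algebra_simps)
  have "((\<lambda>z. p + ?T (z - w)) has_derivative ?T) (at w)"
    by (rule has_derivative_eq_rhs[OF has_derivative_add[OF has_derivative_const
          bounded_linear.has_derivative[OF T has_derivative_diff[OF has_derivative_ident has_derivative_const]]]])
      simp
  moreover have "p + ?T (w - w) = p"
    by (simp add: prod_eq_iff vec_eq_iff)
  then have "(L has_derivative frechet_derivative L (at p)) (at (p + ?T (w - w)))"
    using smooth_map_has_derivative[OF L, of p] by (simp only:)
  ultimately have "((\<lambda>z. L (p + ?T (z - w))) has_derivative (\<lambda>z. frechet_derivative L (at p) (?T z))) (at w)"
    using diff_chain_at by (fastforce simp: o_def)
  then show ?thesis
    unfolding frechet_derivative_complex_linear[OF L hol]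
    by (intro DERIV_imp_deriv) (simp add: has_field_derivative_def mult_commute_abs)
qed

lemma
  fixes L :: "('n::finite, 'r::finite, 'c::finite) lagr_arg \<Rightarrow> complex"
  assumes L: "smooth_map L" and hol: "holomorphic_in_matrices L"
  shows L_o_nth: "L_o L p $ j $ i = frechet_derivative L (at p) (single_entry i j 1, 0, 0, 0, 0)"
    and L_o_star_nth: "L_o_star L p $ i $ j = frechet_derivative L (at p) (0, single_entry j i 1, 0, 0, 0)"
    and L_mu_nth: "L_mu L \<mu> p $ j $ i
      = frechet_derivative L (at p) (0, 0, single_entry (\<mu>, i) j 1, 0, 0)"
    and L_mu_star_nth: "L_mu_star L \<mu> p $ i $ j
      = frechet_derivative L (at p) (0, 0, 0, single_entry j (\<mu>, i) 1, 0)"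
proof -
  obtain P Q R S x where p: "p = (P, Q, R, S, x)"
    by (metis prod_cases5)
  have upd: "update_entry Z k l z = Z + map_matrix ((*) (z - Z $ k $ l)) (single_entry k l 1)"
    for Z :: "complex^'a^'b" and k l z
    by (simp add: vec_eq_iff update_entry_def single_entry_def)
  have zero: "map_matrix ((*) z) 0 = 0" for z :: complex
    by (simp add: vec_eq_iff)
  \<comment> \<open>Entry \<open>(i, j)\<close> of block \<open>\<mu>\<close> is entry
    \<open>((\<mu>, i), j)\<close> of the stacked matrix; for \<open>row\<close> the pair is the
    column index.\<close>
  have col: "col_blocks ((col_block R)(\<mu> := update_entry (col_block R \<mu>) i j z))
      = R + map_matrix ((*) (z - col_block R \<mu> $ i $ j)) (single_entry (\<mu>, i) j 1)" for z
    by (auto simp: vec_eq_iff update_entry_def single_entry_def col_blocks_def col_block_def)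
  have row: "row_blocks ((row_block S)(\<mu> := update_entry (row_block S \<mu>) j i z))
      = S + map_matrix ((*) (z - row_block S \<mu> $ j $ i)) (single_entry j (\<mu>, i) 1)" for z
    by (auto simp: vec_eq_iff update_entry_def single_entry_def row_blocks_def row_block_def)
  note line = deriv_complex_line[OF L hol, of p]
  show "L_o L p $ j $ i = frechet_derivative L (at p) (single_entry i j 1, 0, 0, 0, 0)"
    using line[of "P $ i $ j" "single_entry i j 1" 0 0 0]
    by (simp add: p L_o_def complex_matrix_deriv_def upd zero)
  show "L_o_star L p $ i $ j = frechet_derivative L (at p) (0, single_entry j i 1, 0, 0, 0)"
    using line[of "Q $ j $ i" 0 "single_entry j i 1" 0 0]
    by (simp add: p L_o_star_def complex_matrix_deriv_def upd zero)
  show "L_mu L \<mu> p $ j $ i = frechet_derivative L (at p) (0, 0, single_entry (\<mu>, i) j 1, 0, 0)"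
    using line[of "col_block R \<mu> $ i $ j" 0 0 "single_entry (\<mu>, i) j 1" 0]
    by (simp add: p L_mu_def complex_matrix_deriv_def col zero)
  show "L_mu_star L \<mu> p $ i $ j = frechet_derivative L (at p) (0, 0, 0, single_entry j (\<mu>, i) 1, 0)"
    using line[of "row_block S \<mu> $ j $ i" 0 0 0 "single_entry j (\<mu>, i) 1"]
    by (simp add: p L_mu_star_def complex_matrix_deriv_def row zero)
qed

text \<open>A change by \<open>z\<close> in one entry of the field changes the transposed entry of
  its conjugate transpose by \<open>cnj z\<close>. Complex linearity pulls out both factors, which
  relates real variations to the starred and unstarred derivatives.\<close>

lemma
  fixes L :: "('n::finite, 'r::finite, 'c::finite) lagr_arg \<Rightarrow> complex"
  assumes L: "smooth_map L" and hol: "holomorphic_in_matrices L"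
  shows field_deriv_arg_val: "field_deriv L \<Psi> (arg_val (single_entry i j z)) x
      = z * L_o L (field_arg \<Psi> x) $ j $ i + cnj z * L_o_star L (field_arg \<Psi> x) $ i $ j"
    and field_deriv_arg_grad: "field_deriv L \<Psi> (arg_grad \<mu> (single_entry i j z)) x
      = z * L_mu L \<mu> (field_arg \<Psi> x) $ j $ i + cnj z * L_mu_star L \<mu> (field_arg \<Psi> x) $ i $ j"
proof -
  let ?sc = "\<lambda>z A B C E. (map_matrix ((*) z) A, map_matrix ((*) z) B,
      map_matrix ((*) z) C, map_matrix ((*) z) E, 0 :: real^'n)"
  have val: "arg_val (single_entry i j z)
      = ?sc z (single_entry i j 1) 0 0 0 + ?sc (cnj z) 0 (single_entry j i 1) 0 0"
    by (auto simp: arg_val_def vec_eq_iff single_entry_def)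
  have grad: "arg_grad \<mu> (single_entry i j z)
      = ?sc z 0 0 (single_entry (\<mu>, i) j 1) 0 + ?sc (cnj z) 0 0 0 (single_entry j (\<mu>, i) 1)"
    by (auto simp: arg_grad_def vec_eq_iff single_entry_def col_blocks_def row_blocks_def)
  note add = linear_add[OF linear_field_deriv[OF L]]
  note lin = frechet_derivative_complex_linear[OF L hol]
  show "field_deriv L \<Psi> (arg_val (single_entry i j z)) x
      = z * L_o L (field_arg \<Psi> x) $ j $ i + cnj z * L_o_star L (field_arg \<Psi> x) $ i $ j"
    unfolding val add by (simp only: field_deriv_def lin L_o_nth[OF L hol] L_o_star_nth[OF L hol])
  show "field_deriv L \<Psi> (arg_grad \<mu> (single_entry i j z)) x
      = z * L_mu L \<mu> (field_arg \<Psi> x) $ j $ i + cnj z * L_mu_star L \<mu> (field_arg \<Psi> x) $ i $ j"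
    unfolding grad add by (simp only: field_deriv_def lin L_mu_nth[OF L hol] L_mu_star_nth[OF L hol])
qed

lemma coord_deriv_linear_combination:
  fixes f g :: "real^'n::finite \<Rightarrow> complex"
  assumes "f differentiable at x" "g differentiable at x"
  shows "coord_deriv \<mu> (\<lambda>y. z * f y + w * g y) x = z * coord_deriv \<mu> f x + w * coord_deriv \<mu> g x"
proof -
  obtain f' g' where "(f has_derivative f') (at x)" "(g has_derivative g') (at x)"
    using assms by (auto simp: differentiable_def)
  then show ?thesis
    using coord_deriv_eq[of "\<lambda>y. z * f y + w * g y" "\<lambda>v. z * f' v + w * g' v" x \<mu>]
    by (simp add: coord_deriv_eq has_derivative_add has_derivative_mult_right)
qed

section \<open>The three systems in terms of one expression\<close>

lemma euler_lagrange_single_entry: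
  fixes L :: "('n::finite, 'r::finite, 'c::finite) lagr_arg \<Rightarrow> complex"
  assumes L: "smooth_map L" and hol: "holomorphic_in_matrices L" and \<Psi>: "smooth_map \<Psi>"
  shows "euler_lagrange L \<Psi> (single_entry i j z) x
    = z * (L_o L (field_arg \<Psi> x)
             - (\<Sum>\<mu>\<in>UNIV. coord_deriv \<mu> (\<lambda>y. L_mu L \<mu> (field_arg \<Psi> y)) x)) $ j $ i
      + cnj z * (L_o_star L (field_arg \<Psi> x)
             - (\<Sum>\<mu>\<in>UNIV. coord_deriv \<mu> (\<lambda>y. L_mu_star L \<mu> (field_arg \<Psi> y)) x)) $ i $ j"
proof -
  \<comment> \<open>Each entry is a \<open>field_deriv\<close> in a fixed direction and so
    differentiable, which allows the matrix-valued coordinate derivatives to be taken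
    entrywise.\<close>
  have diff: "(\<lambda>y. L_mu L \<mu> (field_arg \<Psi> y) $ l $ k) differentiable at x"
    "(\<lambda>y. L_mu_star L \<mu> (field_arg \<Psi> y) $ k $ l) differentiable at x" for \<mu> k l
    using field_deriv_differentiable[OF L \<Psi>]
    by (simp_all add: L_mu_nth[OF L hol] L_mu_star_nth[OF L hol] flip: field_deriv_def)
  show ?thesis
    unfolding euler_lagrange_def
    by (simp add: coord_deriv_component diff field_deriv_arg_val[OF L hol]
        field_deriv_arg_grad[OF L hol, abs_def] coord_deriv_linear_combination sum.distrib
        algebra_simps flip: sum_distrib_left)
qed

lemma lagrangian_system_real_iff:
  fixes L :: "('n::finite, 'r::finite, 'c::finite) lagr_arg \<Rightarrow> complex"
  assumes L: "smooth_map L" and \<Psi>: "smooth_map \<Psi>"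
  shows "lagrangian_system_real L \<Psi> \<longleftrightarrow> (\<forall>x i j.
    euler_lagrange L \<Psi> (single_entry i j 1) x = 0 \<and> euler_lagrange L \<Psi> (single_entry i j \<i>) x = 0)"
proof -
  have components: "(dL_Re L \<Psi> x - (\<Sum>\<mu>\<in>UNIV. coord_deriv \<mu> (dL_Re_mu L \<Psi> \<mu>) x)) $ j $ i
      = euler_lagrange L \<Psi> (single_entry i j 1) x"
    "(dL_Im L \<Psi> x - (\<Sum>\<mu>\<in>UNIV. coord_deriv \<mu> (dL_Im_mu L \<Psi> \<mu>) x)) $ j $ i
      = euler_lagrange L \<Psi> (single_entry i j \<i>) x" for x i j
    using field_deriv_differentiable[OF L \<Psi>]
    by (simp_all add: coord_deriv_component euler_lagrange_def dL_Re_nth[OF L \<Psi>] dL_Im_nth[OF L \<Psi>]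
        dL_Re_mu_nth[OF L \<Psi>] dL_Im_mu_nth[OF L \<Psi>])
  show ?thesis
    unfolding lagrangian_system_real_def vec_eq_iff components zero_index by blast
qed

theorem theorem2p4:
  fixes L :: "('n::finite, 'r::finite, 'c::finite) lagr_arg \<Rightarrow> complex"
    and \<S> :: "(real^'n \<Rightarrow> complex^'c^'r) set"
    and \<Psi> :: "real^'n \<Rightarrow> complex^'c^'r"
  assumes "proto_lagrangian L"
    and "admissible_space L \<S>"
    and "\<forall>\<Phi>\<in>\<S>. lagrangian_functional L \<Phi> \<in> \<real>"
    and "\<Psi> \<in> \<S>"
  shows "(lagrangian_system L \<Psi> \<longleftrightarrow> lagrangian_system_star L \<Psi>) \<and>
         (lagrangian_system L \<Psi> \<longleftrightarrow> lagrangian_system_real L \<Psi>)"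
proof -
  have L: "smooth_map L" and hol: "holomorphic_in_matrices L" and \<Psi>: "smooth_map \<Psi>"
    using assms by (auto simp: proto_lagrangian_def admissible_space_def)
  define A where "A x = L_o L (field_arg \<Psi> x)
    - (\<Sum>\<mu>\<in>UNIV. coord_deriv \<mu> (\<lambda>y. L_mu L \<mu> (field_arg \<Psi> y)) x)" for x
  define B where "B x = L_o_star L (field_arg \<Psi> x)
    - (\<Sum>\<mu>\<in>UNIV. coord_deriv \<mu> (\<lambda>y. L_mu_star L \<mu> (field_arg \<Psi> y)) x)" for x
  have EL: "euler_lagrange L \<Psi> (single_entry i j z) x = z * A x $ j $ i + cnj z * B x $ i $ j" for i j z x
    unfolding A_def B_def by (rule euler_lagrange_single_entry[OF L hol \<Psi>])
  \<comment> \<open>For corresponding entries \<open>a\<close> and \<open>b\<close>, the entry 1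
    makes \<open>a + b\<close> real, so their imaginary parts are opposite; the entry
    \<open>\<i>\<close> makes \<open>\<i> * (a - b)\<close> real, so their real parts agree.\<close>
  have B: "B x $ i $ j = cnj (A x $ j $ i)" for x i j
    using euler_lagrange_real[OF L assms(2-4), of "single_entry i j 1" x]
      euler_lagrange_real[OF L assms(2-4), of "single_entry i j \<i>" x]
    by (simp add: EL complex_eq_iff)
  have system: "lagrangian_system L \<Psi> \<longleftrightarrow> (\<forall>x i j. A x $ j $ i = 0)"
    by (auto simp: lagrangian_system_def A_def[symmetric] vec_eq_iff)
  have "lagrangian_system_star L \<Psi> \<longleftrightarrow> (\<forall>x i j. B x $ i $ j = 0)"
    by (auto simp: lagrangian_system_star_def B_def[symmetric] vec_eq_iff)
  then have "lagrangian_system L \<Psi> \<longleftrightarrow> lagrangian_system_star L \<Psi>"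
    by (simp add: system B)
  \<comment> \<open>With \<open>b = cnj a\<close> the two expressions are \<open>2 * Re a\<close>
    and \<open>-2 * Im a\<close>.\<close>
  moreover have "A x $ j $ i + B x $ i $ j = 0 \<and> \<i> * A x $ j $ i - \<i> * B x $ i $ j = 0
      \<longleftrightarrow> A x $ j $ i = 0" for x i j
    by (auto simp: B complex_eq_iff)
  then have "lagrangian_system_real L \<Psi> \<longleftrightarrow> (\<forall>x i j. A x $ j $ i = 0)"
    by (simp add: lagrangian_system_real_iff[OF L \<Psi>] EL)
  ultimately show ?thesis
    by (simp add: system)
qed

end
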